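(* There exist absolute constants $c,C>0$ such that the following holds. Let $\varepsilon\in(0,1/6]$ and $\gamma\in(0,1)$ satisfy $\gamma^{1/\gamma}\le\varepsilon$, let $d$ be an integer with $d\ge C\log(1/\gamma)/\gamma$, and let $\eta\ge c\,\gamma\,\varepsilon\log(1/\varepsilon)$. Then there exist a distribution $\mathcal D$ over $\{\pm1\}^d\times\{\pm1\}$ whose marginal on $\{\pm1\}^d$ is uniform and whose label is a deterministic function of $\mathbf x$, and a distribution $\widehat{\mathcal D}$ with $d_{\mathrm{TV}}(\mathcal D,\widehat{\mathcal D})\le\eta$, such that the class $\mathcal H=\{\mathrm{proj}_i: i\in[d]\}$, $\mathrm{proj}_i(x)=x_i$, satisfies the $\gamma$-weak learning assumption with respect to $\mathcal D$, and for every impurity function $\mathcal G$ and every $t< 2^{\,d - C\log(1/\gamma)/\gamma}$, there is a way of breaking ties in $\textsc{TopDownDT}_{\mathcal H,\mathcal G,\widehat{\mathcal D}}(t)$ for which the output tree $T$ satisfies $\Pr_{(\mathbf x,\mathbf y)\sim\mathcal D}[T(\mathbf x)\ne\mathbf y]>\varepsilon$.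
   Context: Labels and splitting-function values in $\{\pm1\}$ are identified with $\{0,1\}$ via $-1\leftrightarrow 0$, $+1\leftrightarrow 1$. An impurity function is a concave $\mathcal G:[0,1]\to[0,1]$, symmetric around $1/2$, with $\mathcal G(0)=\mathcal G(1)=0$ and $\mathcal G(1/2)=1$. For a distribution $\mathcal E$ write $\mu(\mathcal E)=\Pr_{\mathcal E}[\mathbf y=1]$; for a splitting function $h$ let $\mathcal E|_{h=b}$ denote $\mathcal E$ conditioned on $h(\mathbf x)=b$ and $\Delta_{\mathcal E}(h)=\mathcal G(\mu(\mathcal E))-\sum_{b}\Pr_{\mathcal E}[h(\mathbf x)=b]\,\mathcal G(\mu(\mathcal E|_{h=b}))$ (zero-probability terms are $0$). A decision tree over $\mathcal H$ is a rooted binary tree whose internal nodes are labeled by functions in $\mathcal H$, inputs being routed to the child indexed by the function's value, with labeled leaves; size = number of leaves. For leaf $\ell$, $w_{\mathcal E}(\ell)=\Pr_{\mathcal E}[\mathbf x\text{ reaches }\ell]$, $\mathcal E_\ell$ is $\mathcal E$ conditioned on reaching $\ell$, and $T_{\ell,h}$ replaces leaf $\ell$ by an internal node labeled $h$ with two leaf children. $\textsc{TopDownDT}_{\mathcal H,\mathcal G,\mathcal E}(t)$: start from a single leaf; while size$(T)<t$, pick $(\ell^\star,h^\star)$ maximizing $w_{\mathcal E}(\ell)\Delta_{\mathcal E_\ell}(h)$ over leaves $\ell$ and $h\in\mathcal H$, breaking ties arbitrarily, and set $T\leftarrow T_{\ell^\star,h^\star}$; finally label each leaf $\ell$ by $\mathbf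 1[\mu(\mathcal E_\ell)>1/2]$. Induced distribution: $\mathcal D$ conditioned on an event $h_1(\mathbf x)=b_1,\dots,h_k(\mathbf x)=b_k$ of positive probability ($k\ge0$, $h_i\in\mathcal H$). $\gamma$-weak learning assumption w.r.t. $\mathcal D$: for every induced $\mathcal D'$ there is $h\in\mathcal H$ with $|\mathrm{Cov}_{\mathcal D'}[h(\mathbf x),\mathbf y]|\ge\gamma\,\mathrm{Var}_{\mathcal D'}[\mathbf y]$. $d_{\mathrm{TV}}$ is total variation distance. *)

theory Defs
  imports "HOL-Probability.Probability"
begin

definition Pr :: "'a pmf \<Rightarrow> ('a \<Rightarrow> bool) \<Rightarrow> real" where
  "Pr E P = measure_pmf.prob E {z. P z}"

text \<open>Conditional probability Pr[P | A]; equals 0 when Pr[A] = 0 (division by zero).\<close>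
definition cPr :: "'a pmf \<Rightarrow> ('a \<Rightarrow> bool) \<Rightarrow> ('a \<Rightarrow> bool) \<Rightarrow> real" where
  "cPr E A P = Pr E (\<lambda>z. A z \<and> P z) / Pr E A"

definition mu_c :: "('x \<times> bool) pmf \<Rightarrow> ('x \<Rightarrow> bool) \<Rightarrow> real" where
  "mu_c E A = cPr E (\<lambda>z. A (fst z)) snd"

definition dTV :: "'a pmf \<Rightarrow> 'a pmf \<Rightarrow> real" where
  "dTV P Q = (SUP A. \<bar>measure_pmf.prob P A - measure_pmf.prob Q A\<bar>)"

definition impurity :: "(real \<Rightarrow> real) \<Rightarrow> bool" where
  "impurity G \<longleftrightarrow> concave_on {0..1} G \<and> (\<forall>p\<in>{0..1}. 0 \<le> G p \<and> G p \<le> 1)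
     \<and> (\<forall>p\<in>{0..1}. G (1 - p) = G p) \<and> G 0 = 0 \<and> G 1 = 0 \<and> G (1/2) = 1"

definition Delta_c :: "(real \<Rightarrow> real) \<Rightarrow> ('x \<times> bool) pmf \<Rightarrow> ('x \<Rightarrow> bool) \<Rightarrow> ('x \<Rightarrow> bool) \<Rightarrow> real" where
  "Delta_c G E A h = G (mu_c E A) -
     (\<Sum>b\<in>(UNIV::bool set).
        (let q = cPr E (\<lambda>z. A (fst z)) (\<lambda>z. h (fst z) = b)
         in if q = 0 then 0 else q * G (mu_c E (\<lambda>x. A x \<and> h x = b))))"

text \<open>Unlabelled tree shape; Node h l r routes x to r if h x (i.e. value +1) and to l otherwise.
  Leaves are identified by their paths (list of branch values from the root).\<close>
datatype 'h dtree = Leaf | Node 'h "'h dtree" "'h dtree"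

fun dt_size :: "'h dtree \<Rightarrow> nat" where
  "dt_size Leaf = 1"
| "dt_size (Node h l r) = dt_size l + dt_size r"

fun leaf_paths :: "'h dtree \<Rightarrow> bool list set" where
  "leaf_paths Leaf = {[]}"
| "leaf_paths (Node h l r) = Cons False ` leaf_paths l \<union> Cons True ` leaf_paths r"

fun leaf_of :: "('x \<Rightarrow> bool) dtree \<Rightarrow> 'x \<Rightarrow> bool list" where
  "leaf_of Leaf x = []"
| "leaf_of (Node h l r) x = (if h x then True # leaf_of r x else False # leaf_of l x)"

fun grow :: "'h dtree \<Rightarrow> bool list \<Rightarrow> 'h \<Rightarrow> 'h dtree" where
  "grow Leaf p g = (if p = [] then Node g Leaf Leaf else Leaf)"
| "grow (Node h l r) p g = (case p of [] \<Rightarrow> Node h l r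
     | b # q \<Rightarrow> (if b then Node h l (grow r q g) else Node h (grow l q g) r))"

definition split_score :: "(real \<Rightarrow> real) \<Rightarrow> ('x \<times> bool) pmf \<Rightarrow> ('x \<Rightarrow> bool) dtree
    \<Rightarrow> bool list \<Rightarrow> ('x \<Rightarrow> bool) \<Rightarrow> real" where
  "split_score G E T l h =
     Pr E (\<lambda>z. leaf_of T (fst z) = l) * Delta_c G E (\<lambda>x. leaf_of T x = l) h"

definition greedy_step :: "('x \<Rightarrow> bool) set \<Rightarrow> (real \<Rightarrow> real) \<Rightarrow> ('x \<times> bool) pmf
    \<Rightarrow> ('x \<Rightarrow> bool) dtree \<Rightarrow> ('x \<Rightarrow> bool) dtree \<Rightarrow> bool" where
  "greedy_step H G E T T' \<longleftrightarrow>
     (\<exists>l\<in>leaf_paths T. \<exists>h\<in>H. T' = grow T l h \<and>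
        (\<forall>l'\<in>leaf_paths T. \<forall>h'\<in>H. split_score G E T l' h' \<le> split_score G E T l h))"

text \<open>Trees reachable by the while loop of TopDownDT(t) under some tie-breaking.\<close>
inductive td_reach :: "('x \<Rightarrow> bool) set \<Rightarrow> (real \<Rightarrow> real) \<Rightarrow> ('x \<times> bool) pmf \<Rightarrow> nat
    \<Rightarrow> ('x \<Rightarrow> bool) dtree \<Rightarrow> bool" for H G E t where
  start: "td_reach H G E t Leaf"
| step: "td_reach H G E t T \<Longrightarrow> dt_size T < t \<Longrightarrow> greedy_step H G E T T' \<Longrightarrow> td_reach H G E t T'"

definition td_output :: "('x \<Rightarrow> bool) set \<Rightarrow> (real \<Rightarrow> real) \<Rightarrow> ('x \<times> bool) pmf \<Rightarrow> nat
    \<Rightarrow> ('x \<Rightarrow> bool) dtree \<Rightarrow> bool" where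
  "td_output H G E t T \<longleftrightarrow> td_reach H G E t T \<and> \<not> dt_size T < t"

definition dt_predict :: "('x \<times> bool) pmf \<Rightarrow> ('x \<Rightarrow> bool) dtree \<Rightarrow> 'x \<Rightarrow> bool" where
  "dt_predict E T x \<longleftrightarrow> mu_c E (\<lambda>x'. leaf_of T x' = leaf_of T x) > 1/2"

definition pm1 :: "bool \<Rightarrow> real" where "pm1 b = (if b then 1 else -1)"

definition cov_pmf :: "'a pmf \<Rightarrow> ('a \<Rightarrow> real) \<Rightarrow> ('a \<Rightarrow> real) \<Rightarrow> real" where
  "cov_pmf P f g = measure_pmf.expectation P (\<lambda>z. f z * g z)
     - measure_pmf.expectation P f * measure_pmf.expectation P g"

definition var_pmf :: "'a pmf \<Rightarrow> ('a \<Rightarrow> real) \<Rightarrow> real" where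
  "var_pmf P f = cov_pmf P f f"

definition induced :: "('x \<Rightarrow> bool) set \<Rightarrow> ('x \<times> bool) pmf \<Rightarrow> ('x \<times> bool) pmf \<Rightarrow> bool" where
  "induced H D D' \<longleftrightarrow> (\<exists>cs. set (map fst cs) \<subseteq> H \<and>
      Pr D (\<lambda>z. \<forall>(h,b)\<in>set cs. h (fst z) = b) > 0 \<and>
      D' = cond_pmf D {z. \<forall>(h,b)\<in>set cs. h (fst z) = b})"

definition weak_learning :: "real \<Rightarrow> ('x \<Rightarrow> bool) set \<Rightarrow> ('x \<times> bool) pmf \<Rightarrow> bool" where
  "weak_learning \<gamma> H D \<longleftrightarrow> (\<forall>D'. induced H D D' \<longrightarrow>
     (\<exists>h\<in>H. \<bar>cov_pmf D' (\<lambda>z. pm1 (h (fst z))) (\<lambda>z. pm1 (snd z))\<bar>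
               \<ge> \<gamma> * var_pmf D' (\<lambda>z. pm1 (snd z))))"

definition cube :: "nat \<Rightarrow> bool list set" where
  "cube d = {xs. length xs = d}"

definition proj_class :: "nat \<Rightarrow> (bool list \<Rightarrow> bool) set" where
  "proj_class d = {(\<lambda>x. x ! i) | i. i < d}"

end

theory Submission
  imports Defs
begin

text \<open>
  The target function is \<open>x\<^sub>1 \<and> \<dots> \<and> x\<^sub>m \<and> g\<close>, where \<open>g\<close> is a tribes function (a disjunction of
  \<open>s\<close> disjoint conjunctions of width \<open>w\<close>), \<open>2 ^ w\<close> is about \<open>1 / \<gamma>\<close>, \<open>s\<close> makes \<open>g\<close> roughly balanced,
  and \<open>2 ^ (- m)\<close> is about \<open>\<epsilon>\<close>. In every subcube on which the target is not constant, either a free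
  variable of the outer conjunction or a free variable of a tribe not yet falsified is
  \<open>\<gamma>\<close>-correlated with the label.

  All tribe variables have the same correlation with \<open>g\<close>, of order \<open>\<gamma>\<close>. Hence moving mass of order
  \<open>\<gamma> \<epsilon>\<close> to points whose tribe variables are all equal, labelled by the opposite value, cancels all
  these correlations at once, and this persists under conditioning on the other variables.
  So as long as no tribe variable has been queried, every split on a tribe variable scores 0, and
  ties may always be resolved in favour of the other variables (repeating queries on a path if
  necessary). The resulting tree cannot see the value of \<open>g\<close>, hence errs with constant probability
  on the event \<open>x\<^sub>1 \<and> \<dots> \<and> x\<^sub>m\<close>.
\<close>

section \<open>Probabilities, mixtures and total variation distance\<close>

lemma Pr_nonneg: "0 \<le> Pr E P"
  by (simp add: Pr_def)

lemma Pr_mono: "(\<And>z. P z \<Longrightarrow> Q z) \<Longrightarrow> Pr E P \<le> Pr E Q"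
  unfolding Pr_def by (intro measure_pmf.finite_measure_mono) auto

lemma Pr_split: "Pr E P = Pr E (\<lambda>z. P z \<and> Q z) + Pr E (\<lambda>z. P z \<and> \<not> Q z)"
  unfolding Pr_def
  by (subst measure_pmf.finite_measure_Union[symmetric]) (auto intro!: arg_cong[where f = "measure _"])

lemma Pr_map_pmf_of_set:
  assumes "finite S" "S \<noteq> {}"
  shows "Pr (map_pmf g (pmf_of_set S)) P = real (card {x \<in> S. P (g x)}) / real (card S)"
proof -
  have "S \<inter> g -` {z. P z} = {x \<in> S. P (g x)}" by auto
  then show ?thesis using assms by (simp add: Pr_def measure_pmf_of_set)
qed

definition mix :: "real \<Rightarrow> 'a pmf \<Rightarrow> 'a pmf \<Rightarrow> 'a pmf" where
  "mix a P Q = bind_pmf (bernoulli_pmf a) (\<lambda>b. if b then Q else P)"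

lemma measure_mix:
  assumes "0 \<le> a" "a \<le> 1"
  shows "measure_pmf.prob (mix a P Q) A = (1 - a) * measure_pmf.prob P A + a * measure_pmf.prob Q A"
proof -
  have "ennreal (measure_pmf.prob (mix a P Q) A) =
      ennreal (measure_pmf.prob Q A) * ennreal a + ennreal (measure_pmf.prob P A) * ennreal (1 - a)"
    using assms by (simp add: mix_def flip: measure_pmf.emeasure_eq_measure)
  also have "\<dots> = ennreal ((1 - a) * measure_pmf.prob P A + a * measure_pmf.prob Q A)"
    using assms by (simp add: ennreal_mult' mult.commute add.commute)
  finally show ?thesis
    using assms by (subst (asm) ennreal_inj) auto
qed

lemma dTV_mix_le:
  assumes "0 \<le> a" "a \<le> 1"
  shows "dTV P (mix a P Q) \<le> a"
  unfolding dTV_def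
proof (rule cSUP_least)
  fix A
  have "measure_pmf.prob P A - measure_pmf.prob (mix a P Q) A =
      a * (measure_pmf.prob P A - measure_pmf.prob Q A)"
    by (simp add: measure_mix[OF assms] algebra_simps)
  moreover have "\<bar>measure_pmf.prob P A - measure_pmf.prob Q A\<bar> \<le> 1"
    using measure_pmf.prob_le_1[of P A] measure_pmf.prob_le_1[of Q A]
      measure_nonneg[of P A] measure_nonneg[of Q A] by linarith
  ultimately show "\<bar>measure_pmf.prob P A - measure_pmf.prob (mix a P Q) A\<bar> \<le> a"
    using assms by (simp add: abs_mult mult_left_le)
qed simp

section \<open>Decision trees, split scores and greedy runs\<close>

lemma dtree_of_grow: "set_dtree (grow T l h) \<subseteq> insert h (set_dtree T)"
proof (induction T arbitrary: l)
  case (Node g L R)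
  from Node.IH[of "tl l"] show ?case by (cases l) auto
qed simp

lemma dt_size_grow: "l \<in> leaf_paths T \<Longrightarrow> dt_size (grow T l h) = Suc (dt_size T)"
  by (induction T arbitrary: l) auto

lemma leaf_of_cong: "(\<And>h. h \<in> set_dtree T \<Longrightarrow> h x = h y) \<Longrightarrow> leaf_of T x = leaf_of T y"
  by (induction T) auto

lemma finite_leaf_paths: "finite (leaf_paths T)"
  by (induction T) auto

lemma leaf_paths_nonempty: "leaf_paths T \<noteq> {}"
  by (induction T) auto

text \<open>Jensen: the label mean at the leaf is the average of the children's label means,
  weighted by the branch probabilities, and \<open>G\<close> is concave.\<close>

lemma Delta_c_nonneg:
  assumes G: "impurity G" and pos: "0 < Pr E (\<lambda>z. A (fst z))"
  shows "0 \<le> Delta_c G E A h"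
proof -
  define a where "a = Pr E (\<lambda>z. A (fst z))"
  define p where "p b = Pr E (\<lambda>z. A (fst z) \<and> h (fst z) = b)" for b
  define y where "y b = Pr E (\<lambda>z. (A (fst z) \<and> h (fst z) = b) \<and> snd z)" for b
  have yp: "0 \<le> y b" "y b \<le> p b" for b
    by (auto simp: y_def p_def Pr_nonneg intro: Pr_mono)
  have a: "a = p True + p False"
    unfolding a_def p_def by (subst Pr_split[where Q = "\<lambda>z. h (fst z)"]) simp
  have "Pr E (\<lambda>z. A (fst z) \<and> snd z) = y True + y False"
    unfolding y_def by (subst Pr_split[where Q = "\<lambda>z. h (fst z)"]) (simp add: conj_ac)
  then have mu: "mu_c E A = (y True + y False) / a"
    by (simp add: mu_c_def cPr_def a_def)
  have mub: "mu_c E (\<lambda>x. A x \<and> h x = b) = y b / p b" for b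
    unfolding mu_c_def cPr_def y_def p_def ..
  have q: "cPr E (\<lambda>z. A (fst z)) (\<lambda>z. h (fst z) = b) = p b / a" for b
    unfolding cPr_def p_def a_def ..
  have apos: "0 < a" using pos by (simp add: a_def)
  \<comment> \<open>The case distinction in \<open>Delta_c\<close> disappears, since weight 0 annuls
    the term anyway.\<close>
  have D: "Delta_c G E A h = G (mu_c E A) - (p True / a * G (y True / p True) + p False / a * G (y False / p False))"
  proof -
    have "Delta_c G E A h = G (mu_c E A) - (\<Sum>b\<in>UNIV. p b / a * G (y b / p b))"
      unfolding Delta_c_def q mub Let_def by (intro arg_cong2[where f = minus] sum.cong) auto
    then show ?thesis by (simp add: UNIV_bool)
  qed
  have qy: "p b / a * (y b / p b) = y b / a" for b
    using yp[of b] apos by (cases "p b = 0") auto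
  have cv: "concave_on {0..1} G" using G by (simp add: impurity_def)
  \<comment> \<open>An empty branch is covered too: there \<open>p b = 0\<close> makes the quotient
    0.\<close>
  have r: "y b / p b \<in> {0..1}" for b
    using yp[of b] by (auto simp: divide_le_eq_1)
  have nn: "0 \<le> p b / a" for b using yp[of b] apos by (auto intro!: divide_nonneg_pos)
  have one: "p True / a + p False / a = 1" using a apos by (simp add: add_divide_distrib[symmetric])
  have "(1 - p False / a) * G (y True / p True) + p False / a * G (y False / p False)
      \<le> G ((1 - p False / a) *\<^sub>R (y True / p True) + (p False / a) *\<^sub>R (y False / p False))"
    using nn[of False] nn[of True] one r by (intro concave_onD[OF cv]) (linarith | blast)+
  moreover have "1 - p False / a = p True / a" using one by simp
  ultimately show ?thesis
    unfolding D by (simp add: mu qy add_divide_distrib del: times_divide_eq_right times_divide_eq_left)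
qed

lemma split_score_nonneg: "impurity G \<Longrightarrow> 0 \<le> split_score G E T l h"
  unfolding split_score_def
  using Delta_c_nonneg[of G E "\<lambda>x. leaf_of T x = l" h] Pr_nonneg[of E "\<lambda>z. leaf_of T (fst z) = l"]
  by (cases "Pr E (\<lambda>z. leaf_of T (fst z) = l) = 0") auto

text \<open>Each branch gets weight 1/2 and inherits the label mean of the leaf, so the average
  impurity does not change.\<close>

lemma Delta_c_eq_0:
  assumes pos: "Pr E (\<lambda>z. A (fst z)) \<noteq> 0"
    and eq: "Pr E (\<lambda>z. A (fst z) \<and> h (fst z)) = Pr E (\<lambda>z. A (fst z) \<and> \<not> h (fst z))"
    and eqy: "Pr E (\<lambda>z. (A (fst z) \<and> h (fst z)) \<and> snd z) = Pr E (\<lambda>z. (A (fst z) \<and> \<not> h (fst z)) \<and> snd z)"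
  shows "Delta_c G E A h = 0"
proof -
  define a where "a = Pr E (\<lambda>z. A (fst z))"
  define y where "y = Pr E (\<lambda>z. A (fst z) \<and> snd z)"
  have p: "Pr E (\<lambda>z. A (fst z) \<and> h (fst z) = b) = a / 2" for b
    using eq Pr_split[of E "\<lambda>z. A (fst z)" "\<lambda>z. h (fst z)"] by (cases b) (auto simp: a_def)
  have yb: "Pr E (\<lambda>z. (A (fst z) \<and> h (fst z) = b) \<and> snd z) = y / 2" for b
    using eqy Pr_split[of E "\<lambda>z. A (fst z) \<and> snd z" "\<lambda>z. h (fst z)"]
    by (cases b) (auto simp: y_def conj_ac)
  have "mu_c E (\<lambda>x. A x \<and> h x = b) = mu_c E A" for b
    unfolding mu_c_def cPr_def p yb by (simp add: a_def y_def)
  moreover have "cPr E (\<lambda>z. A (fst z)) (\<lambda>z. h (fst z) = b) = 1 / 2" for b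
    using pos unfolding cPr_def p by (simp add: a_def)
  ultimately show ?thesis by (simp only: Delta_c_def) (simp add: UNIV_bool)
qed

text \<open>Splits outside \<open>H'\<close> score 0 and all scores are nonnegative, so a best split within
  \<open>H'\<close> is a best split overall.\<close>
lemma td_output_avoiding:
  assumes G: "impurity G" and H': "finite H'" "H' \<noteq> {}" "H' \<subseteq> H"
    and zero: "\<And>T l h. set_dtree T \<subseteq> H' \<Longrightarrow> l \<in> leaf_paths T \<Longrightarrow> h \<in> H - H' \<Longrightarrow> split_score G E T l h = 0"
  shows "\<exists>T. td_output H G E t T \<and> set_dtree T \<subseteq> H'"
proof -
  have step: "\<exists>T'. greedy_step H G E T T' \<and> set_dtree T' \<subseteq> H' \<and> dt_size T' = Suc (dt_size T)"
    if T: "set_dtree T \<subseteq> H'" for T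
  proof -
    let ?f = "\<lambda>(l, h). split_score G E T l h"
    have fin: "finite (leaf_paths T \<times> H')" "leaf_paths T \<times> H' \<noteq> {}"
      using finite_leaf_paths leaf_paths_nonempty H' by auto
    then have "Max (?f ` (leaf_paths T \<times> H')) \<in> ?f ` (leaf_paths T \<times> H')" by (intro Max_in) auto
    then obtain l h where lh: "l \<in> leaf_paths T" "h \<in> H'"
      "split_score G E T l h = Max (?f ` (leaf_paths T \<times> H'))" by auto
    have "split_score G E T l' h' \<le> split_score G E T l h" if "l' \<in> leaf_paths T" "h' \<in> H" for l' h'
    proof (cases "h' \<in> H'")
      case True
      then have "?f (l', h') \<le> Max (?f ` (leaf_paths T \<times> H'))"
        using that fin by (intro Max_ge finite_imageI imageI) auto
      then show ?thesis by (simp add: lh)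
    next
      case False
      then show ?thesis using zero[OF T, of l' h'] that split_score_nonneg[OF G] by simp
    qed
    then have "greedy_step H G E T (grow T l h)"
      unfolding greedy_step_def using lh H' by blast
    then show ?thesis
      using dtree_of_grow[of T l h] dt_size_grow[OF lh(1), of h] lh(2) T by blast
  qed
  \<comment> \<open>\<open>n\<close> counts the splits made: they give \<open>n + 1\<close> leaves
    unless the bound \<open>t\<close> was met earlier. For \<open>n = t\<close> either alternative
    is the exit condition of the loop.\<close>
  have "\<exists>T. td_reach H G E t T \<and> set_dtree T \<subseteq> H' \<and> (t \<le> dt_size T \<or> dt_size T = Suc n)" for n
  proof (induction n)
    case 0
    show ?case by (intro exI[of _ Leaf]) (auto intro: td_reach.start)
  next
    case (Suc n)
    then obtain T where T: "td_reach H G E t T" "set_dtree T \<subseteq> H'" "t \<le> dt_size T \<or> dt_size T = Suc n"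
      by blast
    show ?case
    proof (cases "t \<le> dt_size T")
      case False
      then show ?thesis using step[OF T(2)] T td_reach.step[OF T(1)] by (metis not_le)
    qed (use T in blast)
  qed
  from this[of t] show ?thesis unfolding td_output_def by (metis Suc_n_not_le_n not_le le_SucI nat_le_linear)
qed

section \<open>The Boolean cube: flips, overwritten segments and tribe-free inputs\<close>

lemma finite_cube [simp]: "finite (cube d)"
  and card_cube: "card (cube d) = 2 ^ d"
  using finite_lists_length_eq[of "UNIV::bool set" d] card_lists_length_eq[of "UNIV::bool set" d]
  by (auto simp: cube_def)

lemma cube_nonempty [simp]: "cube d \<noteq> {}"
  using Ex_list_of_length[of d] by (auto simp: cube_def)

definition flip :: "nat \<Rightarrow> bool list \<Rightarrow> bool list" where
  "flip i x = x[i := \<not> x ! i]"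

lemma length_flip [simp]: "length (flip i x) = length x"
  by (simp add: flip_def)

lemma nth_flip: "i < length x \<Longrightarrow> flip i x ! l = (if l = i then \<not> x ! i else x ! l)"
  by (simp add: flip_def nth_list_update)

lemma flip_flip [simp]: "flip i (flip i x) = x"
  by (cases "i < length x") (simp_all add: flip_def list_update_beyond)

text \<open>\<open>flip i\<close> is an involution that exchanges the two halves of
  \<open>S\<close>.\<close>

lemma card_flip_eq:
  assumes "finite S" "S \<subseteq> cube d" "i < d" "\<And>x. x \<in> S \<Longrightarrow> flip i x \<in> S"
  shows "card {x \<in> S. x ! i} = card {x \<in> S. \<not> x ! i}"
proof (rule bij_betw_same_card[of "flip i"], rule bij_betw_byWitness[where f' = "flip i"])
  have "length x = d" if "x \<in> S" for x using that assms(2) by (auto simp: cube_def)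
  then show "flip i ` {x \<in> S. x ! i} \<subseteq> {x \<in> S. \<not> x ! i}"
    "flip i ` {x \<in> S. \<not> x ! i} \<subseteq> {x \<in> S. x ! i}"
    using assms by (auto simp: nth_flip)
qed simp_all

definition setseg :: "nat \<Rightarrow> bool list \<Rightarrow> bool list \<Rightarrow> bool list" where
  "setseg p v x = take p x @ v @ drop (p + length v) x"

lemma length_setseg [simp]: "p + length v \<le> length x \<Longrightarrow> length (setseg p v x) = length x"
  by (simp add: setseg_def)

lemma nth_setseg:
  assumes "p + length v \<le> length x" "i < length x"
  shows "setseg p v x ! i = (if p \<le> i \<and> i < p + length v then v ! (i - p) else x ! i)"
  using assms by (auto simp: setseg_def nth_append min_def)

text \<open>The tribes function on its own variables only, a form that can be counted by induction
  on \<open>s\<close>.\<close>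

definition has_tribe :: "nat \<Rightarrow> nat \<Rightarrow> bool list \<Rightarrow> bool" where
  "has_tribe w s u \<longleftrightarrow> (\<exists>j<s. \<forall>i<w. u ! (j * w + i))"

text \<open>The blocks are disjoint, and each independently avoids the all-True pattern in
  \<open>2 ^ w - 1\<close> ways; the induction appends the last block.\<close>

lemma card_not_has_tribe: "card {u \<in> cube (s * w). \<not> has_tribe w s u} = (2 ^ w - 1) ^ s"
proof (induction s)
  case 0
  have "{u \<in> cube (0 * w). \<not> has_tribe w 0 u} = {[]}" by (auto simp: cube_def has_tribe_def)
  then show ?case by simp
next
  case (Suc s)
  let ?U = "{u \<in> cube (s * w). \<not> has_tribe w s u}" and ?V = "cube w - {replicate w True}"
  have V: "card ?V = 2 ^ w - 1" by (subst card_Diff_subset) (simp_all add: card_cube, simp add: cube_def)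
  have tr: "has_tribe w (Suc s) (u @ v) \<longleftrightarrow> has_tribe w s u \<or> v = replicate w True"
    if uv: "length u = s * w" "length v = w" for u v
  proof -
    have "j * w + i < s * w" if "j < s" "i < w" for i j
    proof -
      have "j * w + i < (j + 1) * w" using that by simp
      also have "\<dots> \<le> s * w" using that by (intro mult_right_mono) auto
      finally show ?thesis .
    qed
    then have "has_tribe w s u \<longleftrightarrow> (\<exists>j<s. \<forall>i<w. (u @ v) ! (j * w + i))"
      using uv by (auto simp: has_tribe_def nth_append)
    moreover have "v = replicate w True \<longleftrightarrow> (\<forall>i<w. (u @ v) ! (s * w + i))"
      using uv by (auto simp: nth_append list_eq_iff_nth_eq)
    ultimately show ?thesis by (auto simp: has_tribe_def less_Suc_eq)
  qed
  have "bij_betw (\<lambda>(u, v). u @ v) (?U \<times> ?V) {u \<in> cube (Suc s * w). \<not> has_tribe w (Suc s) u}"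
  proof (rule bij_betw_byWitness[where f' = "\<lambda>x. (take (s * w) x, drop (s * w) x)"])
    show "(\<lambda>(u, v). u @ v) ` (?U \<times> ?V) \<subseteq> {u \<in> cube (Suc s * w). \<not> has_tribe w (Suc s) u}"
      using tr by (auto simp: cube_def)
    show "(\<lambda>x. (take (s * w) x, drop (s * w) x)) ` {u \<in> cube (Suc s * w). \<not> has_tribe w (Suc s) u} \<subseteq> ?U \<times> ?V"
    proof (rule image_subsetI)
      fix x assume x: "x \<in> {u \<in> cube (Suc s * w). \<not> has_tribe w (Suc s) u}"
      then have "length x = s * w + w" by (simp add: cube_def)
      then show "(take (s * w) x, drop (s * w) x) \<in> ?U \<times> ?V"
        using tr[of "take (s * w) x" "drop (s * w) x"] x by (simp add: cube_def)
    qed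
  qed (auto simp: cube_def)
  from bij_betw_same_card[OF this] show ?case by (simp add: card_cartesian_product V Suc mult.commute)
qed

section \<open>Covariance and variance under uniform distributions\<close>

lemma cond_pmf_of_set:
  assumes "finite S" "S \<inter> B \<noteq> {}"
  shows "cond_pmf (pmf_of_set S) B = pmf_of_set (S \<inter> B)"
proof (rule pmf_eqI)
  fix x
  have S: "S \<noteq> {}" using assms by auto
  then have "set_pmf (pmf_of_set S) \<inter> B \<noteq> {}" using assms by (simp add: set_pmf_of_set)
  then show "pmf (cond_pmf (pmf_of_set S) B) x = pmf (pmf_of_set (S \<inter> B)) x"
    using assms S by (simp add: pmf_cond measure_pmf_of_set card_eq_0_iff indicator_def)
qed

lemma card_split: "finite S \<Longrightarrow> card S = card {x \<in> S. P x} + card {x \<in> S. \<not> P x}"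
  by (subst card_Un_disjoint[symmetric]) (auto intro: arg_cong[where f = card])

text \<open>A balanced \<open>g\<close> has mean 0, and its excess among the negatives is minus its
  excess among the positives. Hence the factor 2 and a formula in the positives alone.\<close>

lemma cov_pm1_uniform:
  assumes S: "finite S" "S \<noteq> {}" and bal: "card {x \<in> S. g x} = card {x \<in> S. \<not> g x}"
  shows "cov_pmf (map_pmf (\<lambda>x. (x, f x)) (pmf_of_set S)) (\<lambda>z. pm1 (g (fst z))) (\<lambda>z. pm1 (snd z)) =
    2 * (real (card {x \<in> S. f x \<and> g x}) - real (card {x \<in> S. f x \<and> \<not> g x})) / card S"
proof -
  have sum: "(\<Sum>x\<in>S. pm1 (P x)) = real (card {x \<in> S. P x}) - real (card {x \<in> S. \<not> P x})" for P
  proof -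
    have "(\<Sum>x\<in>S. pm1 (P x)) = (\<Sum>x\<in>S. of_bool (P x) - of_bool (\<not> P x))"
      by (intro sum.cong) (auto simp: pm1_def)
    then show ?thesis using S by (simp add: sum_subtractf sum.inter_filter[symmetric] of_bool_def)
  qed
  have pm1_mult: "pm1 a * pm1 b = pm1 (a = b)" for a b by (simp add: pm1_def)
  have *: "card {x \<in> S. P x} = card {x \<in> S. f x \<and> P x} + card {x \<in> S. \<not> f x \<and> P x}" for P
    using S(1) card_split[of "{x \<in> S. P x}" f] by (simp add: conj_ac)
  show ?thesis
    using S bal *[of g] *[of "\<lambda>x. \<not> g x"] *[of "\<lambda>x. f x = g x"] *[of "\<lambda>x. f x \<noteq> g x"]
    by (simp add: cov_pmf_def integral_pmf_of_set pm1_mult sum field_simps cong: conj_cong)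
qed

lemma var_pm1_uniform:
  assumes S: "finite S" "S \<noteq> {}"
  shows "var_pmf (map_pmf (\<lambda>x. (x, f x)) (pmf_of_set S)) (\<lambda>z. pm1 (snd z)) =
    4 * (real (card {x \<in> S. f x}) * real (card {x \<in> S. \<not> f x})) / (real (card S))\<^sup>2"
proof -
  let ?a = "real (card {x \<in> S. f x})" and ?b = "real (card {x \<in> S. \<not> f x})"
  have "(\<Sum>x\<in>S. pm1 (f x)) = (\<Sum>x\<in>S. of_bool (f x) - of_bool (\<not> f x))"
    by (intro sum.cong) (auto simp: pm1_def)
  then have sum: "(\<Sum>x\<in>S. pm1 (f x)) = ?a - ?b"
    using S by (simp add: sum_subtractf sum.inter_filter[symmetric] of_bool_def)
  have n: "real (card S) = ?a + ?b" using card_split[OF S(1), of f] by simp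
  have pos: "0 < ?a + ?b" using S n by (metis card_gt_0_iff of_nat_0_less_iff)
  have sq: "pm1 a * pm1 a = 1" for a by (simp add: pm1_def)
  have "var_pmf (map_pmf (\<lambda>x. (x, f x)) (pmf_of_set S)) (\<lambda>z. pm1 (snd z))
      = 1 - ((?a - ?b) / (?a + ?b)) * ((?a - ?b) / (?a + ?b))"
    using S pos by (simp add: var_pmf_def cov_pmf_def integral_pmf_of_set sum sq n)
  also have "\<dots> = 4 * (?a * ?b) / (?a + ?b)\<^sup>2"
    using pos by (simp add: divide_simps power2_eq_square) (simp add: algebra_simps)
  finally show ?thesis by (simp add: n)
qed

section \<open>Choice of the parameters\<close>

text \<open>Rounds a real threshold to an integer exponent: \<open>y ^ n\<close> exceeds
  \<open>\<theta>\<close>, but by less than a further factor of \<open>y\<close> can undo.\<close>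

lemma power_crossing:
  fixes y \<theta> :: real
  assumes "0 \<le> y" "y < 1" "0 < \<theta>" "\<theta> < 1"
  obtains n where "\<theta> < y ^ n" "y ^ Suc n \<le> \<theta>"
proof -
  obtain N where N: "y ^ N \<le> \<theta>" using real_arch_pow_inv[OF assms(3,2)] less_imp_le by blast
  define k where "k = (LEAST n. y ^ n \<le> \<theta>)"
  have k: "y ^ k \<le> \<theta>" unfolding k_def using N by (rule LeastI)
  then obtain n where n: "k = Suc n" using assms(4) by (cases k) auto
  have "\<not> y ^ n \<le> \<theta>" unfolding k_def using n not_less_Least[of n "\<lambda>n. y ^ n \<le> \<theta>"] k_def by simp
  then show ?thesis using k n by (intro that) auto
qed

lemma exponent_le_ln:
  assumes "2 ^ n \<le> (x::real)"
  shows "real n \<le> 3 / 2 * ln x"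
proof -
  have "real n * ln 2 = ln (2 ^ n)" by (simp add: ln_realpow)
  also have "\<dots> \<le> ln x" using assms by (subst ln_le_cancel_iff) (auto intro: less_le_trans[of 0 "2 ^ n"])
  finally have "real n * (2 / 3) \<le> ln x"
    using mult_left_mono[OF ln2_ge_two_thirds, of "real n"] by simp
  then show ?thesis by simp
qed

text \<open>\<open>2 ^ (- m)\<close> is placed between \<open>3 * \<epsilon>\<close> and
  \<open>6 * \<epsilon>\<close>, \<open>2 ^ w\<close> just below
  \<open>1 + 1 / (2 * \<gamma>)\<close> up to a factor 2, and the probability that no tribe is true
  between 1/3 and 2/3. The conclusions serve, in order, nontrivial blocks, weak learning, the
  dimension budget, the corruption weight and the error.\<close>

lemma tribes_parameters:
  fixes \<epsilon> \<gamma> :: real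
  assumes \<epsilon>: "0 < \<epsilon>" "\<epsilon> \<le> 1 / 6" and \<gamma>: "0 < \<gamma>" "\<gamma> powr (1 / \<gamma>) \<le> \<epsilon>"
  obtains m w s :: nat where "0 < w" "2 * \<gamma> * (2 ^ w - 1) \<le> 1"
    "real (m + s * w) + 1 \<le> 4 * ln (1 / \<gamma>) / \<gamma>"
    "2 * ((2 ^ w - 1) ^ s / ((2 ^ w - 1) * 2 ^ (m + s * w))) \<le> 64 * \<gamma> * \<epsilon>"
    "\<epsilon> < min ((2 ^ w - 1) ^ s) (2 ^ (s * w) - (2 ^ w - 1) ^ s) / 2 ^ (m + s * w)"
proof -
  define L where "L = ln (1 / \<gamma>) / \<gamma>"
  \<comment> \<open>In logarithms the hypothesis reads \<open>ln (1 / \<epsilon>) \<le> L\<close>.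
    It bounds \<open>m\<close> and, together with \<open>\<epsilon> \<le> 1 / 6\<close>, forces
    \<open>\<gamma> < 1 / 2\<close>.\<close>
  have "ln (\<gamma> powr (1 / \<gamma>)) \<le> ln \<epsilon>" using \<gamma> \<epsilon> by (subst ln_le_cancel_iff) auto
  then have L: "ln (1 / \<epsilon>) \<le> L" using \<gamma> \<epsilon> by (simp add: ln_powr ln_div L_def)
  have "ln 6 \<le> ln (1 / \<epsilon>)" using \<epsilon> by (subst ln_le_cancel_iff) (auto simp: field_simps)
  then have L6: "ln 6 \<le> L" using L by simp
  have "ln (exp 1) \<le> ln (6::real)" using exp_le by (subst ln_le_cancel_iff) auto
  then have L1: "1 \<le> L" using L6 by simp
  \<comment> \<open>Otherwise \<open>L \<le> 2 * ln 2 = ln 4 < ln 6\<close>.\<close>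
  have half: "\<gamma> < 1 / 2"
  proof (rule ccontr)
    assume "\<not> \<gamma> < 1 / 2"
    then have g: "1 / 2 \<le> \<gamma>" by simp
    then have "ln (1 / \<gamma>) \<le> ln 2" using \<gamma> by (subst ln_le_cancel_iff) (auto simp: field_simps)
    then have "ln (1 / \<gamma>) / \<gamma> \<le> ln 2 / (1 / 2)" using g by (intro frac_le) auto
    also have "\<dots> = ln ((2::real) ^ 2)" by (subst ln_realpow) auto
    also have "\<dots> < ln 6" by simp
    finally show False using L6 by (simp add: L_def)
  qed
  \<comment> \<open>The factor 3 pays for the later loss of 2/3 of the event that all gate variables
    are on.\<close>
  obtain m where m: "3 * \<epsilon> < (1 / 2) ^ m" "(1 / 2) ^ Suc m \<le> 3 * \<epsilon>"
    using power_crossing[of "1 / 2" "3 * \<epsilon>"] \<epsilon> by auto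
  obtain w where w: "1 / (1 + 1 / (2 * \<gamma>)) < (1 / 2) ^ w" "(1 / 2) ^ Suc w \<le> 1 / (1 + 1 / (2 * \<gamma>))"
    using power_crossing[of "1 / 2" "1 / (1 + 1 / (2 * \<gamma>))"] \<gamma> by (auto simp: field_simps)
  have w0: "w \<noteq> 0"
  proof
    assume "w = 0"
    then show False using w(2) half \<gamma> by (simp add: field_simps)
  qed
  then obtain w' where w': "w = Suc w'" by (cases w) auto
  have w2: "2 \<le> (2::real) ^ w" by (simp add: w')
  have wu: "2 ^ w \<le> 1 + 1 / (2 * \<gamma>)" using w(1) \<gamma> by (simp add: power_one_over field_simps)
  have wl: "1 + 1 / (2 * \<gamma>) \<le> 2 * 2 ^ w" using w(2) \<gamma> by (simp add: power_one_over field_simps)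
  define y :: real where "y = 1 - 1 / 2 ^ w"
  have y: "1 / 2 \<le> y" "y < 1" using w2 by (auto simp: y_def field_simps)
  \<comment> \<open>One more factor \<open>y \<ge> 1 / 2\<close> takes \<open>y ^ n > 2 / 3\<close>
    to a value above 1/3, so \<open>s = n + 1\<close> makes the tribes function roughly
    balanced.\<close>
  obtain n where n: "2 / 3 < y ^ n" "y ^ Suc n \<le> 2 / 3"
    using power_crossing[of y "2 / 3"] y by auto
  define s where "s = Suc n"
  have ys: "1 / 3 < y ^ s" "y ^ s \<le> 2 / 3"
  proof -
    have "2 / 3 * (1 / 2) < y ^ n * y" using n y by (intro mult_less_le_imp_less) auto
    then show "1 / 3 < y ^ s" by (simp add: s_def mult.commute)
  qed (use n in \<open>simp add: s_def\<close>)
  \<comment> \<open>Bounds \<open>s\<close> by \<open>2 ^ w\<close>: the chain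
    \<open>2 / 3 < y ^ n \<le> 1 / (1 + n / 2 ^ w)\<close> gives
    \<open>n < 2 ^ w / 2\<close>.\<close>
  have "y \<le> exp (- (1 / 2 ^ w))" using exp_ge_add_one_self[of "- (1 / 2 ^ w)"] by (simp add: y_def)
  then have "y ^ n \<le> exp (- (1 / 2 ^ w)) ^ n" using y by (intro power_mono) auto
  also have "\<dots> = 1 / exp (real n / 2 ^ w)" by (simp add: exp_of_nat_mult[symmetric] exp_minus field_simps)
  also have "\<dots> \<le> 1 / (1 + real n / 2 ^ w)"
    using exp_ge_add_one_self[of "real n / 2 ^ w"] by (intro divide_left_mono) (auto intro!: mult_pos_pos add_pos_nonneg)
  finally have "2 / 3 < 1 / (1 + real n / 2 ^ w)" using n by simp
  moreover have "0 < 1 + real n / 2 ^ w" by (intro add_pos_nonneg) auto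
  ultimately have "real n / 2 ^ w < 1 / 2" by (simp add: field_simps)
  then have s_le: "real s \<le> 2 ^ w" using w2 by (simp add: s_def field_simps)
  have yq: "(2 ^ w - 1) ^ s / 2 ^ (s * w) = y ^ s"
  proof -
    have "(2 ^ w - 1) / 2 ^ w = y" by (simp add: y_def field_simps)
    then show ?thesis by (metis power_divide power_mult mult.commute)
  qed
  show ?thesis
  proof (rule that)
    show "0 < w" using w0 by simp
    show "2 * \<gamma> * (2 ^ w - 1) \<le> 1" using wu \<gamma> by (simp add: field_simps)
    have wg: "2 ^ w \<le> 1 / \<gamma>" using wu \<gamma> half by (simp add: field_simps)
    have "real s * real w \<le> 1 / \<gamma> * (3 / 2 * ln (1 / \<gamma>))"
      using order_trans[OF s_le wg] exponent_le_ln[OF wg] \<gamma> by (intro mult_mono) auto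
    also have "\<dots> = 3 / 2 * L" by (simp add: L_def)
    finally have sw: "real s * real w \<le> 3 / 2 * L" .
    have "2 ^ m \<le> 1 / \<epsilon>" using m(1) \<epsilon> by (simp add: power_one_over field_simps)
    from exponent_le_ln[OF this] have "real m \<le> 3 / 2 * L" using L by simp
    \<comment> \<open>Gate and tribes take at most \<open>3 / 2 * L\<close> each; the remaining
      \<open>L \<ge> 1\<close> pays for one spare coordinate.\<close>
    then have "real (m + s * w) + 1 \<le> 4 * L" using sw L1 by simp
    then show "real (m + s * w) + 1 \<le> 4 * ln (1 / \<gamma>) / \<gamma>" by (simp add: L_def)
    have "1 / (8 * \<gamma>) \<le> 2 ^ w - 1" using wl w2 by (simp add: field_simps)
    then have "1 / (2 ^ w - 1) \<le> 8 * \<gamma>" using w2 \<gamma> by (simp add: field_simps)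
    moreover have "(1 / 2) ^ m \<le> 6 * \<epsilon>" using m(2) by simp
    \<comment> \<open>After doubling, the right-hand side is the source of the constant
      \<open>64 = 2 * (2 / 3) * 6 * 8\<close>.\<close>
    ultimately have "y ^ s * ((1 / 2) ^ m * (1 / (2 ^ w - 1))) \<le> 2 / 3 * (6 * \<epsilon> * (8 * \<gamma>))"
      using ys \<epsilon> \<gamma> w2 by (intro mult_mono) auto
    then show "2 * ((2 ^ w - 1) ^ s / ((2 ^ w - 1) * 2 ^ (m + s * w))) \<le> 64 * \<gamma> * \<epsilon>"
      by (simp add: yq[symmetric] power_add power_one_over field_simps)
    have "\<epsilon> < (1 / 2) ^ m * (1 / 3)" using m(1) by simp
    also have "\<dots> \<le> (1 / 2) ^ m * min (y ^ s) (1 - y ^ s)" using ys by (intro mult_left_mono) auto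
    also have "\<dots> = min ((2 ^ w - 1) ^ s) (2 ^ (s * w) - (2 ^ w - 1) ^ s) / 2 ^ (m + s * w)"
    proof -
      have "min (y ^ s) (1 - y ^ s) = min ((2 ^ w - 1) ^ s / 2 ^ (s * w)) ((2 ^ (s * w) - (2 ^ w - 1) ^ s) / 2 ^ (s * w))"
        by (simp add: yq[symmetric] diff_divide_distrib)
      also have "\<dots> = min ((2 ^ w - 1) ^ s) (2 ^ (s * w) - (2 ^ w - 1) ^ s) / 2 ^ (s * w)"
        by (simp add: min_divide_distrib_right)
      finally show ?thesis by (simp add: power_add power_one_over)
    qed
    finally show "\<epsilon> < min ((2 ^ w - 1) ^ s) (2 ^ (s * w) - (2 ^ w - 1) ^ s) / 2 ^ (m + s * w)" .
  qed
qed

section \<open>The gated tribes function and its pivotal inputs\<close>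

locale tribes =
  fixes m w s r :: nat
  assumes w_pos: "0 < w" and r_pos: "0 < r"
begin

text \<open>Layout: \<open>m\<close> gate variables, then \<open>s\<close> blocks of
  \<open>w\<close> tribe variables, then \<open>r\<close> free ones. As \<open>r > 0\<close>, a
  greedy run has a query outside the tribes even when \<open>m = 0\<close>.\<close>

definition dim :: nat where "dim = m + s * w + r"

definition tribe :: "nat \<Rightarrow> bool list \<Rightarrow> bool" where
  "tribe j x \<longleftrightarrow> (\<forall>i<w. x ! (m + j * w + i))"

definition some_tribe :: "bool list \<Rightarrow> bool" where
  "some_tribe x \<longleftrightarrow> (\<exists>j<s. tribe j x)"

definition gate :: "bool list \<Rightarrow> bool" where
  "gate x \<longleftrightarrow> (\<forall>i<m. x ! i)"

definition target :: "bool list \<Rightarrow> bool" where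
  "target x \<longleftrightarrow> gate x \<and> some_tribe x"

text \<open>For \<open>j < s\<close>, the inputs where block \<open>j\<close> alone makes
  \<open>some_tribe\<close> true, so that each of its variables is pivotal.\<close>

definition sole_tribe :: "nat \<Rightarrow> bool list \<Rightarrow> bool" where
  "sole_tribe j x \<longleftrightarrow> tribe j x \<and> (\<forall>j'<s. j' \<noteq> j \<longrightarrow> \<not> tribe j' x)"

text \<open>Captures what a tree that never queries a tribe variable can compute.\<close>

definition irrelevant_to_tribes :: "(bool list \<Rightarrow> 'b) \<Rightarrow> bool" where
  "irrelevant_to_tribes A \<longleftrightarrow> (\<forall>x\<in>cube dim. \<forall>y\<in>cube dim.
     (\<forall>i<dim. i < m \<or> m + s * w \<le> i \<longrightarrow> x ! i = y ! i) \<longrightarrow> A x = A y)"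

lemma block_index:
  assumes "j < s" "e < w" shows "m + j * w + e < m + s * w"
proof -
  have "j * w + e < (j + 1) * w" using assms by simp
  also have "\<dots> \<le> s * w" using assms by (intro mult_right_mono) auto
  finally show ?thesis by simp
qed

lemma block_end: "j < s \<Longrightarrow> m + j * w + w \<le> m + s * w"
  using block_index[of j "w - 1"] w_pos by simp

lemma blocks_disjoint:
  assumes "e < w" "e' < w" "m + j * w + e = m + j' * w + e'" shows "j = j'"
proof -
  have "j * w + e = j' * w + e'" using assms by simp
  then have "(j * w + e) div w = (j' * w + e') div w" by simp
  then show ?thesis using assms by simp
qed

lemma nth_setseg_other_block:
  assumes "length v = w" "x \<in> cube dim" "j < s" "j' < s" "j' \<noteq> j" "e < w"
  shows "setseg (m + j * w) v x ! (m + j' * w + e) = x ! (m + j' * w + e)"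
proof -
  have "\<not> (m + j * w \<le> m + j' * w + e \<and> m + j' * w + e < m + j * w + w)"
  proof
    assume *: "m + j * w \<le> m + j' * w + e \<and> m + j' * w + e < m + j * w + w"
    define e' where "e' = m + j' * w + e - (m + j * w)"
    have "m + j' * w + e = m + j * w + e'" "e' < w" using * unfolding e'_def by linarith+
    then have "j' = j" using assms(6) blocks_disjoint[of e e' j' j] by blast
    with assms show False by simp
  qed
  then show ?thesis
    using assms block_index[of j' e] block_end[of j]
    by (subst nth_setseg) (auto simp: cube_def dim_def)
qed

lemma tribe_setseg:
  assumes "length v = w" "x \<in> cube dim" "j < s"
  shows "tribe j (setseg (m + j * w) v x) \<longleftrightarrow> v = replicate w True"
    and "\<And>j'. j' < s \<Longrightarrow> j' \<noteq> j \<Longrightarrow> tribe j' (setseg (m + j * w) v x) = tribe j' x"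
proof -
  have "setseg (m + j * w) v x ! (m + j * w + e) = v ! e" if "e < w" for e
    using assms that block_end[of j] block_index[of j e]
    by (subst nth_setseg) (auto simp: cube_def dim_def)
  then show "tribe j (setseg (m + j * w) v x) \<longleftrightarrow> v = replicate w True"
    using assms by (auto simp: tribe_def list_eq_iff_nth_eq)
  show "tribe j' (setseg (m + j * w) v x) = tribe j' x" if "j' < s" "j' \<noteq> j" for j'
    using nth_setseg_other_block[OF assms that] by (simp add: tribe_def)
qed

text \<open>Flipping \<open>i\<close> embeds the satisfied inputs with \<open>i\<close> off into
  those with \<open>i\<close> on. The image misses exactly the inputs that the flip would falsify,
  those whose only true tribe is \<open>j\<close>.\<close>

lemma card_pivotal:
  assumes S: "finite S" "S \<subseteq> cube dim" "\<And>x. x \<in> S \<Longrightarrow> flip i x \<in> S"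
    and i: "i = m + j * w + e" "j < s" "e < w"
  shows "card {x \<in> S. some_tribe x \<and> x ! i} =
    card {x \<in> S. some_tribe x \<and> \<not> x ! i} + card {x \<in> S. sole_tribe j x}"
proof -
  have len: "i < length x" if "x \<in> S" for x
    using that S(2) block_index[OF i(2,3)] i(1) by (auto simp: cube_def dim_def)
  have other: "tribe j' (flip i x) = tribe j' x" if "x \<in> S" "j' < s" "j' \<noteq> j" for x j'
    unfolding tribe_def
  proof (intro all_cong1 imp_cong refl)
    fix e' assume "e' < w"
    then have "m + j' * w + e' \<noteq> i" using blocks_disjoint[of e' e j' j] i that(3) by auto
    then show "flip i x ! (m + j' * w + e') = x ! (m + j' * w + e')"
      using len[OF that(1)] by (simp add: nth_flip)
  qed
  have own: "x ! i" if "tribe j x" for x using that i by (auto simp: tribe_def)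
  let ?N = "{x \<in> S. some_tribe x \<and> \<not> x ! i}"
  have eq: "{x \<in> S. some_tribe x \<and> x ! i} = flip i ` ?N \<union> {x \<in> S. sole_tribe j x}" (is "?L = ?R")
  proof (intro equalityI subsetI)
    fix x assume x: "x \<in> ?L"
    show "x \<in> ?R"
    proof (cases "sole_tribe j x")
      case False
      then obtain j' where j': "j' < s" "j' \<noteq> j" "tribe j' x"
        using x by (auto simp: sole_tribe_def some_tribe_def)
      then have "some_tribe (flip i x)" using other[of x j'] x by (auto simp: some_tribe_def)
      then have "flip i x \<in> ?N" using x S(3) len by (auto simp: nth_flip)
      then show ?thesis by (intro UnI1 image_eqI[of _ _ "flip i x"]) simp_all
    qed (use x in blast)
  next
    fix x assume "x \<in> ?R"
    then consider y where "y \<in> ?N" "x = flip i y" | "x \<in> S" "sole_tribe j x" by auto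
    then show "x \<in> ?L"
    proof cases
      case 1
      then obtain j' where j': "j' < s" "tribe j' y" by (auto simp: some_tribe_def)
      then have "j' \<noteq> j" using own 1 by auto
      then have "some_tribe x" using other[of y j'] 1 j' by (auto simp: some_tribe_def)
      then show ?thesis using 1 S(3) len by (auto simp: nth_flip)
    next
      case 2
      then show ?thesis using own i by (auto simp: sole_tribe_def some_tribe_def)
    qed
  qed
  have disj: "flip i ` ?N \<inter> {x \<in> S. sole_tribe j x} = {}"
  proof -
    have False if y: "y \<in> ?N" "sole_tribe j (flip i y)" for y
    proof -
      obtain j' where j': "j' < s" "tribe j' y" using y(1) by (auto simp: some_tribe_def)
      then have "j' \<noteq> j" using own y by auto
      then show False using other[of y j'] y j' by (auto simp: sole_tribe_def)
    qed
    then show ?thesis by auto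
  qed
  have "inj_on (flip i) ?N" by (rule inj_on_inverseI[of _ "flip i"]) simp
  then show ?thesis
    unfolding eq using S(1) disj by (subst card_Un_disjoint) (auto simp: card_image)
qed

text \<open>Turning block \<open>j\<close> on loses only its old contents, and writing them back
  recovers \<open>x\<close>; this is what bounds the fibres in the next count.\<close>

lemma fibre:
  assumes "x \<in> cube dim" "j < s" "y = setseg (m + j * w) (replicate w True) x"
  shows "x = setseg (m + j * w) (take w (drop (m + j * w) x)) y"
proof -
  have "x = take (m + j * w) x @ take w (drop (m + j * w) x) @ drop (m + j * w + w) x"
    by (metis append_take_drop_id drop_drop add.commute)
  then show ?thesis
    using assms block_end[of j] by (auto simp: setseg_def cube_def dim_def min_def)
qed

text \<open>Turning block \<open>j\<close> on maps the inputs without a true tribe to those whose only true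
  tribe is \<open>j\<close>, and at most \<open>2 ^ w - 1\<close> inputs share an image.\<close>
lemma card_no_tribe_le:
  assumes S: "finite S" "S \<subseteq> cube dim" and j: "j < s"
    and cl: "\<And>x. x \<in> S \<Longrightarrow> setseg (m + j * w) (replicate w True) x \<in> S"
  shows "card {x \<in> S. \<not> some_tribe x} \<le> card {x \<in> S. sole_tribe j x} * (2 ^ w - 1)"
proof -
  let ?V = "cube w - {replicate w True}"
  let ?F = "\<lambda>(y, v). setseg (m + j * w) v y"
  have V: "card ?V = 2 ^ w - 1" by (subst card_Diff_subset) (simp_all add: card_cube, simp add: cube_def)
  have "{x \<in> S. \<not> some_tribe x} \<subseteq> ?F ` ({x \<in> S. sole_tribe j x} \<times> ?V)"
  proof
    fix x assume x: "x \<in> {x \<in> S. \<not> some_tribe x}"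
    then have xc: "x \<in> cube dim" using S by auto
    define y where "y = setseg (m + j * w) (replicate w True) x"
    define v where "v = take w (drop (m + j * w) x)"
    have lv: "length v = w"
      using xc block_end[OF j] by (simp add: v_def cube_def dim_def)
    have y: "y \<in> S" "sole_tribe j y"
      using x xc cl j tribe_setseg[of "replicate w True" x j]
      by (auto simp: y_def sole_tribe_def some_tribe_def)
    have xe: "x = setseg (m + j * w) v y"
      using fibre[OF xc j y_def] by (simp add: v_def)
    have "v \<noteq> replicate w True"
      using tribe_setseg(1)[OF lv _ j, of y] xe x y S j by (auto simp: some_tribe_def)
    then show "x \<in> ?F ` ({x \<in> S. sole_tribe j x} \<times> ?V)"
      using xe y lv by (auto simp: cube_def intro!: image_eqI[of _ _ "(y, v)"])
  qed
  then have "card {x \<in> S. \<not> some_tribe x} \<le> card ({x \<in> S. sole_tribe j x} \<times> ?V)"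
    using S(1) by (intro surj_card_le) auto
  then show ?thesis by (simp add: card_cartesian_product V)
qed

text \<open>When block \<open>j\<close> may be overwritten freely within \<open>S\<close>, each of
  the \<open>2 ^ w - 1\<close> other fillings of a sole true tribe yields a tribe-free input, so the
  fibres have exactly that size.\<close>

lemma card_no_tribe_eq:
  assumes S: "finite S" "S \<subseteq> cube dim" and j: "j < s"
    and cl: "\<And>x v. x \<in> S \<Longrightarrow> length v = w \<Longrightarrow> setseg (m + j * w) v x \<in> S"
  shows "card {x \<in> S. \<not> some_tribe x} = card {x \<in> S. sole_tribe j x} * (2 ^ w - 1)"
proof (rule antisym)
  show "card {x \<in> S. \<not> some_tribe x} \<le> card {x \<in> S. sole_tribe j x} * (2 ^ w - 1)"
    using assms by (intro card_no_tribe_le) auto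
next
  let ?V = "cube w - {replicate w True}"
  let ?F = "\<lambda>(y, v). setseg (m + j * w) v y"
  have V: "card ?V = 2 ^ w - 1" by (subst card_Diff_subset) (simp_all add: card_cube, simp add: cube_def)
  have inj: "y = y' \<and> v = v'"
    if y: "y \<in> S" "sole_tribe j y" "length v = w" and y': "y' \<in> S" "sole_tribe j y'" "length v' = w"
      and eq: "setseg (m + j * w) v y = setseg (m + j * w) v' y'" for y y' v v'
  proof -
    have c: "length y = dim" "length y' = dim"
      using y y' S by (auto simp: cube_def)
    have b: "m + j * w + w \<le> dim" using block_end[OF j] by (simp add: dim_def)
    have v: "v = v'" and rest: "take (m + j * w) y = take (m + j * w) y'"
      "drop (m + j * w + w) y = drop (m + j * w + w) y'"
      using eq c b y(3) y'(3) by (auto simp: setseg_def)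
    \<comment> \<open>Overwriting forgets block \<open>j\<close>, but in both inputs it was all
      True.\<close>
    have mid: "take w (drop (m + j * w) y) = take w (drop (m + j * w) y')"
      using y y' c b by (intro nth_equalityI) (auto simp: sole_tribe_def tribe_def)
    have split: "x = take (m + j * w) x @ take w (drop (m + j * w) x) @ drop (m + j * w + w) x"
      for x :: "bool list"
      by (metis append_take_drop_id drop_drop add.commute)
    have "y = y'" by (subst (1 2) split) (simp add: rest mid)
    with v show ?thesis by simp
  qed
  have "inj_on ?F ({x \<in> S. sole_tribe j x} \<times> ?V)"
  proof (rule inj_onI)
    fix p p' assume p: "p \<in> {x \<in> S. sole_tribe j x} \<times> ?V" "p' \<in> {x \<in> S. sole_tribe j x} \<times> ?V"
      "?F p = ?F p'"
    obtain y v y' v' where eqs: "p = (y, v)" "p' = (y', v')" by (cases p, cases p')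
    have "y = y' \<and> v = v'" using p unfolding eqs by (intro inj) (simp_all add: cube_def)
    then show "p = p'" by (simp add: eqs)
  qed
  moreover have "?F p \<in> {x \<in> S. \<not> some_tribe x}" if "p \<in> {x \<in> S. sole_tribe j x} \<times> ?V" for p
  proof -
    obtain y v where p: "p = (y, v)" by (cases p)
    have y: "y \<in> S" "sole_tribe j y" "length v = w" "v \<noteq> replicate w True"
      using that by (auto simp: p cube_def)
    have "\<not> tribe j' (setseg (m + j * w) v y)" if "j' < s" for j'
      using tribe_setseg[of v y j] y S j that
      by (cases "j' = j") (auto simp: sole_tribe_def)
    then show ?thesis
      using cl y by (simp add: some_tribe_def p)
  qed
  ultimately have "card ({x \<in> S. sole_tribe j x} \<times> ?V) \<le> card {x \<in> S. \<not> some_tribe x}"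
    using S(1) by (intro card_inj_on_le[of ?F]) auto
  then show "card {x \<in> S. sole_tribe j x} * (2 ^ w - 1) \<le> card {x \<in> S. \<not> some_tribe x}"
    by (simp add: card_cartesian_product V)
qed

section \<open>Weak learning for the clean distribution\<close>

definition clean :: "(bool list \<times> bool) pmf" where
  "clean = map_pmf (\<lambda>x. (x, target x)) (pmf_of_set (cube dim))"

text \<open>With \<open>a\<close> positives and \<open>b\<close> negatives among \<open>n\<close>
  points, the variance is \<open>4 * a * b / n^2\<close> and the covariance
  \<open>2 * c / n\<close>. One of \<open>a\<close>, \<open>b\<close> is at most
  \<open>c * (2 ^ w - 1)\<close> and the other at most \<open>n\<close>; the bound on
  \<open>\<gamma>\<close> absorbs \<open>2 ^ w - 1\<close>.\<close>

lemma weak_learner: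
  assumes S: "S \<subseteq> cube dim" "S \<noteq> {}" and \<gamma>: "0 < \<gamma>" "2 * \<gamma> * (2 ^ w - 1) \<le> 1"
    and fl: "\<And>x. x \<in> S \<Longrightarrow> flip i x \<in> S" and i: "i < dim"
    and gap: "card {x \<in> S. target x \<and> x ! i} = card {x \<in> S. target x \<and> \<not> x ! i} + c"
    and c: "card {x \<in> S. target x} \<le> c * (2 ^ w - 1) \<or> card {x \<in> S. \<not> target x} \<le> c * (2 ^ w - 1)"
  shows "\<gamma> * var_pmf (map_pmf (\<lambda>x. (x, target x)) (pmf_of_set S)) (\<lambda>z. pm1 (snd z))
    \<le> \<bar>cov_pmf (map_pmf (\<lambda>x. (x, target x)) (pmf_of_set S)) (\<lambda>z. pm1 (fst z ! i)) (\<lambda>z. pm1 (snd z))\<bar>"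
proof -
  have fin: "finite S" using S(1) finite_cube by (rule finite_subset)
  let ?n = "real (card S)"
  define a where "a = real (card {x \<in> S. target x})"
  define b where "b = real (card {x \<in> S. \<not> target x})"
  have bal: "card {x \<in> S. x ! i} = card {x \<in> S. \<not> x ! i}"
    using fin S i fl by (intro card_flip_eq)
  have n: "0 < ?n" using fin S by (simp add: card_gt_0_iff)
  have ab: "0 \<le> a" "0 \<le> b" "a \<le> ?n" "b \<le> ?n"
    unfolding a_def b_def using fin by (auto intro!: card_mono)
  have w1: "real (2 ^ w - 1) = 2 ^ w - 1" by (simp add: of_nat_diff)
  have "a \<le> real c * (2 ^ w - 1) \<or> b \<le> real c * (2 ^ w - 1)"
    using c unfolding a_def b_def w1[symmetric] of_nat_mult[symmetric] of_nat_le_iff .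
  then have "a * b \<le> (real c * (2 ^ w - 1)) * ?n"
  proof
    assume "a \<le> real c * (2 ^ w - 1)"
    then show ?thesis using ab by (intro mult_mono) auto
  next
    assume "b \<le> real c * (2 ^ w - 1)"
    then have "b * a \<le> (real c * (2 ^ w - 1)) * ?n" using ab by (intro mult_mono) auto
    then show ?thesis by (simp add: mult.commute)
  qed
  then have "2 * \<gamma> * (a * b) \<le> 2 * \<gamma> * ((real c * (2 ^ w - 1)) * ?n)"
    using \<gamma> by (intro mult_left_mono) auto
  also have "\<dots> = (2 * \<gamma> * (2 ^ w - 1)) * (real c * ?n)" by simp
  also have "\<dots> \<le> 1 * (real c * ?n)" using \<gamma> by (intro mult_right_mono) auto
  finally have "\<gamma> * (4 * (a * b)) \<le> 2 * real c * ?n" by simp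
  then have "\<gamma> * (4 * (a * b) / ?n\<^sup>2) \<le> 2 * real c / ?n"
    using n by (simp add: field_simps power2_eq_square)
  then show ?thesis
    unfolding var_pm1_uniform[OF fin S(2)] cov_pm1_uniform[OF fin S(2) bal] gap
    by (simp add: a_def b_def)
qed

text \<open>An induced distribution is uniform on a subcube \<open>S\<close>. If the target is
  constant there, the variance is 0. Otherwise a free gate variable is on at all positives, or else
  the gate holds on \<open>S\<close> and a free variable of a tribe that can still be true has the
  pivotal inputs as its gap.\<close>

lemma weak_learning_clean:
  assumes \<gamma>: "0 < \<gamma>" "2 * \<gamma> * (2 ^ w - 1) \<le> 1"
  shows "weak_learning \<gamma> (proj_class dim) clean"
  unfolding weak_learning_def
proof (intro allI impI)
  fix D' assume "induced (proj_class dim) clean D'"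
  then obtain cs where cs: "set (map fst cs) \<subseteq> proj_class dim"
    and pos: "Pr clean (\<lambda>z. \<forall>(h,b)\<in>set cs. h (fst z) = b) > 0"
    and D': "D' = cond_pmf clean {z. \<forall>(h,b)\<in>set cs. h (fst z) = b}"
    unfolding induced_def by blast
  define S where "S = {x \<in> cube dim. \<forall>(h,b)\<in>set cs. h x = b}"
  have S: "S \<subseteq> cube dim" "finite S" by (auto simp: S_def)
  have SE: "cube dim \<inter> (\<lambda>x. (x, target x)) -` {z. \<forall>(h,b)\<in>set cs. h (fst z) = b} = S"
    by (auto simp: S_def)
  have "0 < real (card S) / real (card (cube dim))"
    using pos unfolding clean_def by (subst (asm) Pr_map_pmf_of_set) (simp_all add: S_def)
  then have ne: "S \<noteq> {}" by auto
  have D'S: "D' = map_pmf (\<lambda>x. (x, target x)) (pmf_of_set S)"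
    unfolding D' clean_def using ne SE by (subst cond_map_pmf) (simp_all add: cond_pmf_of_set)
  \<comment> \<open>The coordinates left free by the conditions.\<close>
  define F where "F i \<longleftrightarrow> (\<forall>b. ((\<lambda>x. x ! i), b) \<notin> set cs)" for i
  have mem: "y \<in> S" if "x \<in> S" "length y = length x" "\<And>i. i < dim \<Longrightarrow> \<not> F i \<Longrightarrow> y ! i = x ! i" for x y
    unfolding S_def
  proof (intro CollectI conjI ballI, clarify?)
    show "y \<in> cube dim" using that by (simp add: S_def cube_def)
    fix p assume p: "p \<in> set cs"
    obtain h b where hb: "p = (h, b)" by (cases p)
    obtain i where i: "i < dim" "h = (\<lambda>x. x ! i)" using p cs hb by (force simp: proj_class_def)
    then have "\<not> F i" using p hb by (auto simp: F_def)
    then have "h y = h x" using that i by simp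
    then show "case p of (h, b) \<Rightarrow> h y = b" using that(1) p hb by (auto simp: S_def)
  qed
  have fixed: "x ! i = y ! i" if "x \<in> S" "y \<in> S" "\<not> F i" for x y i
    using that by (fastforce simp: F_def S_def)
  have fl: "flip i x \<in> S" if "x \<in> S" "F i" "i < dim" for x i
  proof (rule mem[OF that(1)])
    fix l assume "l < dim" "\<not> F l"
    then show "flip i x ! l = x ! l" using that S by (subst nth_flip) (auto simp: cube_def)
  qed simp
  have main: "\<exists>h\<in>proj_class dim. \<gamma> * var_pmf D' (\<lambda>z. pm1 (snd z)) \<le>
      \<bar>cov_pmf D' (\<lambda>z. pm1 (h (fst z))) (\<lambda>z. pm1 (snd z))\<bar>"
    if "F i" "i < dim" "card {x \<in> S. target x \<and> x ! i} = card {x \<in> S. target x \<and> \<not> x ! i} + c"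
      "card {x \<in> S. target x} \<le> c * (2 ^ w - 1) \<or> card {x \<in> S. \<not> target x} \<le> c * (2 ^ w - 1)"
    for i c
    using weak_learner[OF S(1) ne \<gamma> fl that(2,3,4)] that(1,2)
    unfolding D'S by (intro bexI[of _ "\<lambda>x. x ! i"]) (auto simp: proj_class_def)
  show "\<exists>h\<in>proj_class dim. \<gamma> * var_pmf D' (\<lambda>z. pm1 (snd z)) \<le>
      \<bar>cov_pmf D' (\<lambda>z. pm1 (h (fst z))) (\<lambda>z. pm1 (snd z))\<bar>"
  proof (cases "(\<exists>x\<in>S. target x) \<and> (\<exists>x\<in>S. \<not> target x)")
    case False
    then have "{x \<in> S. target x} = {} \<or> {x \<in> S. \<not> target x} = {}" by auto
    then have "card {x \<in> S. target x} = 0 \<or> card {x \<in> S. \<not> target x} = 0"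
      by (elim disjE) (simp_all only: card.empty simp_thms)
    then have "var_pmf D' (\<lambda>z. pm1 (snd z)) = 0"
      unfolding D'S var_pm1_uniform[OF S(2) ne] by (elim disjE) (simp_all only: of_nat_0 mult_zero_left mult_zero_right div_0)
    then show ?thesis
      using r_pos by (intro bexI[of _ "\<lambda>x. x ! 0"]) (auto simp: proj_class_def dim_def intro!: exI[of _ 0])
  next
    case True
    then obtain x1 x0 where x1: "x1 \<in> S" "target x1" and x0: "x0 \<in> S" "\<not> target x0" by blast
    show ?thesis
    proof (cases "\<exists>i<m. F i")
      case True
      then obtain i where i: "i < m" "F i" by blast
      have on: "{x \<in> S. target x \<and> x ! i} = {x \<in> S. target x}"
        and off: "{x \<in> S. target x \<and> \<not> x ! i} = {}"
        using i by (auto simp: target_def gate_def)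
      have "1 \<le> 2 ^ w - (1::nat)" using power_increasing[of 1 w "2::nat"] w_pos by simp
      then have "card {x \<in> S. target x} \<le> card {x \<in> S. target x} * (2 ^ w - 1)"
        using mult_le_mono2[of 1 "2 ^ w - 1" "card {x \<in> S. target x}"] by simp
      then show ?thesis
        using i by (intro main[of i "card {x \<in> S. target x}"])
          (simp_all only: on off card.empty add_0 simp_thms dim_def trans_less_add1)
    next
      case False
      \<comment> \<open>All gate variables are fixed, hence fixed to their values in the positive
        input \<open>x1\<close>.\<close>
      have g: "gate x" if "x \<in> S" for x
        using x1 that False fixed[OF that x1(1)] by (auto simp: target_def gate_def)
      then have tg: "x \<in> S \<and> target x \<longleftrightarrow> x \<in> S \<and> some_tribe x" for x by (auto simp: target_def)
      obtain j where j: "j < s" "tribe j x1" using x1 by (auto simp: target_def some_tribe_def)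
      have "\<not> tribe j x0" using x0 g j tg[of x0] by (auto simp: some_tribe_def)
      then obtain e where e: "e < w" "\<not> x0 ! (m + j * w + e)" by (auto simp: tribe_def)
      define i where "i = m + j * w + e"
      have i: "i < dim" using block_index[OF j(1) e(1)] by (simp add: i_def dim_def)
      have Fi: "F i" using fixed[OF x0(1) x1(1), of i] e j by (auto simp: i_def tribe_def)
      have tgt: "{x \<in> S. target x \<and> P x} = {x \<in> S. some_tribe x \<and> P x}"
        "{x \<in> S. \<not> target x} = {x \<in> S. \<not> some_tribe x}" for P
        using tg by blast+
      \<comment> \<open>The fixed coordinates of block \<open>j\<close> are already True, as they
        agree with \<open>x1\<close>, so turning the block on changes free coordinates only.\<close>
      have cl: "setseg (m + j * w) (replicate w True) x \<in> S" if x: "x \<in> S" for x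
      proof (rule mem[OF x])
        have lx: "length x = dim" using x S by (auto simp: cube_def)
        have b: "m + j * w + w \<le> dim" using block_end[OF j(1)] by (simp add: dim_def)
        show "length (setseg (m + j * w) (replicate w True) x) = length x" using lx b by simp
        show "setseg (m + j * w) (replicate w True) x ! i = x ! i" if i: "i < dim" "\<not> F i" for i
        proof (cases "m + j * w \<le> i \<and> i < m + j * w + w")
          case True
          then have "i - (m + j * w) < w" by linarith
          then have "x1 ! (m + j * w + (i - (m + j * w)))" using j(2) unfolding tribe_def by blast
          then have "x ! i" using fixed[OF x x1(1) i(2)] True by simp
          then show ?thesis using True lx b by (subst nth_setseg) (use i in auto)
        qed (use lx b i in \<open>subst nth_setseg; auto\<close>)
      qed
      show ?thesis
      proof (rule main[OF Fi i])
        show "card {x \<in> S. target x \<and> x ! i} =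
            card {x \<in> S. target x \<and> \<not> x ! i} + card {x \<in> S. sole_tribe j x}"
          unfolding tgt using S fl[OF _ Fi i] i_def j(1) e(1) by (intro card_pivotal) auto
        show "card {x \<in> S. target x} \<le> card {x \<in> S. sole_tribe j x} * (2 ^ w - 1) \<or>
            card {x \<in> S. \<not> target x} \<le> card {x \<in> S. sole_tribe j x} * (2 ^ w - 1)"
          unfolding tgt using S cl j by (intro disjI2 card_no_tribe_le) auto
      qed
    qed
  qed
qed

section \<open>The corruption and the cancellation of tribe correlations\<close>

text \<open>A shared value \<open>b\<close> with label \<open>\<not> b\<close> makes all tribe
  variables equally anticorrelated with the label. The free part stays uniform, so conditioning
  outside the tribes scales this effect as it scales the clean correlation within the gate.\<close>

definition corruption :: "(bool list \<times> bool) pmf" where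
  "corruption = map_pmf (\<lambda>(b, z). (replicate m True @ replicate (s * w) b @ z, \<not> b))
     (pmf_of_set (UNIV \<times> cube r))"

definition noisy :: "real \<Rightarrow> (bool list \<times> bool) pmf" where
  "noisy a = mix a clean corruption"

text \<open>Counts the free parts compatible with \<open>A\<close> when the gate is on. The tribe
  filling False is just a representative when \<open>A\<close> ignores the tribes.\<close>

definition tails :: "(bool list \<Rightarrow> bool) \<Rightarrow> nat" where
  "tails A = card {z \<in> cube r. A (replicate m True @ replicate (s * w) False @ z)}"

lemma irrelevant_to_tribesD:
  assumes "irrelevant_to_tribes A" "u \<in> cube (s * w)" "z \<in> cube r"
  shows "A (replicate m True @ u @ z) = A (replicate m True @ replicate (s * w) False @ z)"
  by (rule assms(1)[unfolded irrelevant_to_tribes_def, rule_format])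
    (use assms(2,3) in \<open>auto simp: cube_def dim_def nth_append\<close>)

lemma some_tribe_append:
  assumes "u \<in> cube (s * w)"
  shows "some_tribe (replicate m True @ u @ z) \<longleftrightarrow> has_tribe w s u"
proof -
  have "(replicate m True @ u @ z) ! (m + j * w + i) = u ! (j * w + i)" if "j < s" "i < w" for i j
    using block_index[OF that] assms by (simp add: nth_append cube_def)
  then show ?thesis by (auto simp: some_tribe_def tribe_def has_tribe_def)
qed

text \<open>With the gate on, inputs split into a tribe filling and a free part; \<open>A\<close>
  constrains only the latter and \<open>some_tribe\<close> only the former.\<close>

lemma card_gate:
  assumes "irrelevant_to_tribes A"
  shows "card {x \<in> cube dim. A x \<and> gate x \<and> some_tribe x = b} =
    tails A * card {u \<in> cube (s * w). has_tribe w s u = b}"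
proof -
  let ?Z = "{z \<in> cube r. A (replicate m True @ replicate (s * w) False @ z)}"
  let ?U = "{u \<in> cube (s * w). has_tribe w s u = b}"
  have "bij_betw (\<lambda>(z, u). replicate m True @ u @ z) (?Z \<times> ?U)
    {x \<in> cube dim. A x \<and> gate x \<and> some_tribe x = b}"
  proof (rule bij_betw_byWitness[where f' = "\<lambda>x. (drop (m + s * w) x, take (s * w) (drop m x))"])
    show "(\<lambda>(z, u). replicate m True @ u @ z) ` (?Z \<times> ?U)
        \<subseteq> {x \<in> cube dim. A x \<and> gate x \<and> some_tribe x = b}"
    proof (rule image_subsetI)
      fix p assume "p \<in> ?Z \<times> ?U"
      then obtain z u where p: "p = (z, u)" and z: "z \<in> ?Z" and u: "u \<in> ?U" by blast
      have "A (replicate m True @ u @ z)" using irrelevant_to_tribesD[OF assms, of u z] z u by blast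
      moreover have "some_tribe (replicate m True @ u @ z) = b" using some_tribe_append u by blast
      moreover have "replicate m True @ u @ z \<in> cube dim" using z u by (simp add: cube_def dim_def)
      moreover have "gate (replicate m True @ u @ z)" by (simp add: gate_def nth_append)
      ultimately show "(case p of (z, u) \<Rightarrow> replicate m True @ u @ z)
          \<in> {x \<in> cube dim. A x \<and> gate x \<and> some_tribe x = b}" by (simp add: p)
    qed
    have split: "x = replicate m True @ take (s * w) (drop m x) @ drop (m + s * w) x"
      if "x \<in> cube dim" "gate x" for x
    proof -
      have "take m x = replicate m True"
        using that by (intro nth_equalityI) (auto simp: cube_def dim_def gate_def)
      then show ?thesis by (metis append_take_drop_id drop_drop add.commute)
    qed
    then show "\<forall>x\<in>{x \<in> cube dim. A x \<and> gate x \<and> some_tribe x = b}.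
        (\<lambda>(z, u). replicate m True @ u @ z) (drop (m + s * w) x, take (s * w) (drop m x)) = x"
      by auto
    show "(\<lambda>x. (drop (m + s * w) x, take (s * w) (drop m x))) `
        {x \<in> cube dim. A x \<and> gate x \<and> some_tribe x = b} \<subseteq> ?Z \<times> ?U"
    proof (rule image_subsetI)
      fix x assume x: "x \<in> {x \<in> cube dim. A x \<and> gate x \<and> some_tribe x = b}"
      define u where "u = take (s * w) (drop m x)"
      define z where "z = drop (m + s * w) x"
      have uz: "u \<in> cube (s * w)" "z \<in> cube r" using x by (auto simp: u_def z_def cube_def dim_def)
      have xe: "x = replicate m True @ u @ z" unfolding u_def z_def using split x by blast
      have "A x" "some_tribe x = b" using x by auto
      then show "(drop (m + s * w) x, take (s * w) (drop m x)) \<in> ?Z \<times> ?U"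
        using irrelevant_to_tribesD[OF assms uz] some_tribe_append[OF uz(1), of z] uz
        unfolding u_def[symmetric] z_def[symmetric] xe[symmetric] by blast
    qed
  qed (auto simp: cube_def)
  from bij_betw_same_card[OF this] show ?thesis by (simp add: card_cartesian_product tails_def)
qed

lemma Pr_clean: "Pr clean P = real (card {x \<in> cube dim. P (x, target x)}) / 2 ^ dim"
  unfolding clean_def by (simp add: Pr_map_pmf_of_set card_cube)

text \<open>Fixing a tribe variable to \<open>c\<close> forces \<open>b = c\<close>, whence the 1/2
  and the label \<open>\<not> c\<close>. The predicate \<open>Y\<close> lets one formula give both
  the total and the positive mass.\<close>

lemma Pr_corruption:
  assumes A: "irrelevant_to_tribes A" and i: "m \<le> i" "i < m + s * w"
  shows "Pr corruption (\<lambda>z. (A (fst z) \<and> fst z ! i = c) \<and> Y (snd z)) =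
    (if Y (\<not> c) then real (tails A) / (2 * 2 ^ r) else 0)"
proof -
  let ?x = "\<lambda>b z. replicate m True @ replicate (s * w) b @ z"
  have "i - m < s * w" using i by linarith
  then have nth: "?x b z ! i = b" for b z using i by (simp add: nth_append)
  have A': "A (?x b z) = A (?x False z)" if "z \<in> cube r" for b z
    using irrelevant_to_tribesD[OF A _ that, of "replicate (s * w) b"] by (simp add: cube_def)
  have eq: "{x \<in> UNIV \<times> cube r. (A (fst (case x of (b, z) \<Rightarrow> (?x b z, \<not> b)))
      \<and> fst (case x of (b, z) \<Rightarrow> (?x b z, \<not> b)) ! i = c) \<and> Y (snd (case x of (b, z) \<Rightarrow> (?x b z, \<not> b)))}
    = (if Y (\<not> c) then {c} \<times> {z \<in> cube r. A (?x False z)} else {})"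
    (is "?L = ?R")
  proof (intro set_eqI)
    fix p :: "bool \<times> bool list"
    obtain b z where "p = (b, z)" by (cases p)
    then show "p \<in> ?L \<longleftrightarrow> p \<in> ?R"
      using A'[of z b] by (cases b; cases c) (auto simp: nth)
  qed
  have "Pr corruption (\<lambda>z. (A (fst z) \<and> fst z ! i = c) \<and> Y (snd z)) =
      real (card (if Y (\<not> c) then {c} \<times> {z \<in> cube r. A (?x False z)} else {})) /
      real (card ((UNIV :: bool set) \<times> cube r))"
    unfolding corruption_def eq[symmetric] by (rule Pr_map_pmf_of_set) auto
  then show ?thesis by (simp add: card_cartesian_product card_cube tails_def)
qed

text \<open>\<open>p\<close> counts the pivotal inputs in \<open>A\<close> with the gate on. It
  depends on \<open>A\<close> only through \<open>tails A\<close> and is the same for every tribe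
  variable, so a single corruption weight can cancel them all.\<close>

lemma card_tribe_var:
  assumes A: "irrelevant_to_tribes A" and i: "m \<le> i" "i < m + s * w"
  obtains p where "p * (2 ^ w - 1) = tails A * (2 ^ w - 1) ^ s"
    "card {x \<in> cube dim. (A x \<and> x ! i) \<and> target x} = card {x \<in> cube dim. (A x \<and> \<not> x ! i) \<and> target x} + p"
    "card {x \<in> cube dim. A x \<and> x ! i} = card {x \<in> cube dim. A x \<and> \<not> x ! i}"
proof
  define S where "S = {x \<in> cube dim. A x \<and> gate x}"
  define j where "j = (i - m) div w"
  define e where "e = (i - m) mod w"
  have "j < s" unfolding j_def by (rule less_mult_imp_div_less) (use i in linarith)
  moreover have "e < w" using w_pos by (simp add: e_def)
  moreover have "i = m + j * w + e" using i by (simp add: j_def e_def)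
  ultimately have je: "j < s" "e < w" "i = m + j * w + e" by auto
  have same: "A y = A x \<and> gate y = gate x"
    if "x \<in> cube dim" "y \<in> cube dim" "\<And>l. l < dim \<Longrightarrow> l < m \<or> m + s * w \<le> l \<Longrightarrow> x ! l = y ! l" for x y
  proof -
    have "A x = A y" using A that unfolding irrelevant_to_tribes_def by blast
    moreover have "gate x = gate y" using that(3) by (auto simp: gate_def dim_def)
    ultimately show ?thesis by simp
  qed
  have idim: "i < dim" using i by (simp add: dim_def)
  have fl: "flip i x \<in> cube dim \<and> A (flip i x) = A x \<and> gate (flip i x) = gate x"
    if "x \<in> cube dim" for x
  proof -
    have c: "flip i x \<in> cube dim" using that by (simp add: cube_def)
    have "x ! l = flip i x ! l" if "l < dim" "l < m \<or> m + s * w \<le> l" for l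
      using that \<open>x \<in> cube dim\<close> i idim by (subst nth_flip) (auto simp: cube_def)
    then show ?thesis using same[OF that c] c by blast
  qed
  have ss: "setseg (m + j * w) v x \<in> cube dim \<and> A (setseg (m + j * w) v x) = A x
      \<and> gate (setseg (m + j * w) v x) = gate x"
    if "x \<in> cube dim" "length v = w" for x v
  proof -
    have b: "m + j * w + w \<le> m + s * w" using block_end[OF je(1)] .
    then have "setseg (m + j * w) v x \<in> cube dim" using that by (auto simp: cube_def dim_def)
    moreover have "x ! l = setseg (m + j * w) v x ! l" if "l < dim" "l < m \<or> m + s * w \<le> l" for l
      using \<open>x \<in> cube dim\<close> \<open>length v = w\<close> that b
      by (subst nth_setseg) (auto simp: cube_def dim_def)
    ultimately show ?thesis using same[OF that(1)] by blast
  qed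
  have S: "finite S" "S \<subseteq> cube dim" by (auto simp: S_def)
  have "card {x \<in> S. sole_tribe j x} * (2 ^ w - 1) = card {x \<in> S. \<not> some_tribe x}"
    using S je ss by (intro card_no_tribe_eq[symmetric]) (auto simp: S_def)
  also have "{x \<in> S. \<not> some_tribe x} = {x \<in> cube dim. A x \<and> gate x \<and> some_tribe x = False}"
    by (auto simp: S_def)
  also have "card \<dots> = tails A * (2 ^ w - 1) ^ s"
    using card_gate[OF A, of False] card_not_has_tribe[of s w] by simp
  finally show "card {x \<in> S. sole_tribe j x} * (2 ^ w - 1) = tails A * (2 ^ w - 1) ^ s" .
  have "card {x \<in> S. some_tribe x \<and> x ! i} =
      card {x \<in> S. some_tribe x \<and> \<not> x ! i} + card {x \<in> S. sole_tribe j x}"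
    using S fl je by (intro card_pivotal) (auto simp: S_def)
  moreover have "{x \<in> S. some_tribe x \<and> P x} = {x \<in> cube dim. (A x \<and> P x) \<and> target x}" for P
    by (auto simp: S_def target_def)
  ultimately show "card {x \<in> cube dim. (A x \<and> x ! i) \<and> target x} =
      card {x \<in> cube dim. (A x \<and> \<not> x ! i) \<and> target x} + card {x \<in> S. sole_tribe j x}"
    by simp
  show "card {x \<in> cube dim. A x \<and> x ! i} = card {x \<in> cube dim. A x \<and> \<not> x ! i}"
    using card_flip_eq[of "{x \<in> cube dim. A x}" dim i] fl idim by simp
qed

text \<open>The weight at which the corruption cancels the correlation of every tribe variable with
  the label.\<close>
definition balancing :: "real \<Rightarrow> bool" where
  "balancing a \<longleftrightarrow> 0 \<le> a \<and> a \<le> 1 \<and>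
     (1 - a) * ((2 ^ w - 1) ^ s / ((2 ^ w - 1) * 2 ^ (m + s * w))) = a / 2"

lemma Pr_noisy:
  assumes "balancing a"
  shows "Pr (noisy a) P = (1 - a) * Pr clean P + a * Pr corruption P"
  using assms unfolding balancing_def noisy_def Pr_def by (intro measure_mix) auto

text \<open>Both sides of the split have equal mass. The clean part puts \<open>p / 2 ^ dim\<close>
  more positive mass on the True side, the corruption \<open>tails A / (2 * 2 ^ r)\<close> more on
  the False side. Both are proportional to \<open>tails A\<close>, so \<open>balancing\<close>
  equates them at every leaf.\<close>

lemma split_score_tribe_var:
  assumes a: "balancing a" and i: "m \<le> i" "i < m + s * w"
    and T: "irrelevant_to_tribes (leaf_of T)"
  shows "split_score G (noisy a) T l (\<lambda>x. x ! i) = 0"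
proof -
  define A where "A x \<longleftrightarrow> leaf_of T x = l" for x
  have A: "irrelevant_to_tribes A"
    using T unfolding irrelevant_to_tribes_def A_def by metis
  obtain p where p: "p * (2 ^ w - 1) = tails A * (2 ^ w - 1) ^ s"
    "card {x \<in> cube dim. (A x \<and> x ! i) \<and> target x} = card {x \<in> cube dim. (A x \<and> \<not> x ! i) \<and> target x} + p"
    "card {x \<in> cube dim. A x \<and> x ! i} = card {x \<in> cube dim. A x \<and> \<not> x ! i}"
    using card_tribe_var[OF A i] by blast
  have "Pr corruption (\<lambda>z. A (fst z) \<and> fst z ! i) = Pr corruption (\<lambda>z. A (fst z) \<and> \<not> fst z ! i)"
    using Pr_corruption[OF A i, of True "\<lambda>_. True"] Pr_corruption[OF A i, of False "\<lambda>_. True"] by simp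
  then have eq: "Pr (noisy a) (\<lambda>z. A (fst z) \<and> fst z ! i) = Pr (noisy a) (\<lambda>z. A (fst z) \<and> \<not> fst z ! i)"
    by (simp add: Pr_noisy[OF a] Pr_clean p(3))
  have w1: "real (2 ^ w - 1) = 2 ^ w - 1" "(0::real) < 2 ^ w - 1"
    using w_pos by (simp_all add: of_nat_diff)
  have "real p * (2 ^ w - 1) = real (tails A) * (2 ^ w - 1) ^ s"
    using p(1) by (metis of_nat_mult of_nat_power w1(1))
  then have "real p = real (tails A) * ((2 ^ w - 1) ^ s / (2 ^ w - 1))"
    using w1(2) by (simp add: field_simps)
  then have "(1 - a) * (real p / 2 ^ dim) =
      ((1 - a) * ((2 ^ w - 1) ^ s / ((2 ^ w - 1) * 2 ^ (m + s * w)))) * (real (tails A) / 2 ^ r)"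
    by (simp add: dim_def power_add mult_ac)
  also have "\<dots> = a / 2 * (real (tails A) / 2 ^ r)"
    using a unfolding balancing_def by presburger
  finally have bal: "(1 - a) * (real p / 2 ^ dim) = a * (real (tails A) / (2 * 2 ^ r))" by simp
  have "Pr (noisy a) (\<lambda>z. (A (fst z) \<and> fst z ! i) \<and> snd z) =
      Pr (noisy a) (\<lambda>z. (A (fst z) \<and> \<not> fst z ! i) \<and> snd z)"
    using Pr_corruption[OF A i, of True "\<lambda>y. y"] Pr_corruption[OF A i, of False "\<lambda>y. y"] bal
    by (simp add: Pr_noisy[OF a] Pr_clean p(2)[unfolded conj_assoc] add_divide_distrib distrib_left)
  then have "Pr (noisy a) (\<lambda>z. A (fst z)) = 0 \<or> Delta_c G (noisy a) A (\<lambda>x. x ! i) = 0"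
    using Delta_c_eq_0[of "noisy a" A "\<lambda>x. x ! i" G] eq by blast
  then show ?thesis unfolding split_score_def A_def by auto
qed

section \<open>Error of trees that avoid the tribe variables\<close>

text \<open>For each free part with the gate on, \<open>P\<close> is constant over the tribe
  fillings, so it errs on all tribe-free fillings or on all others.\<close>

lemma Pr_error:
  assumes P: "irrelevant_to_tribes P"
  shows "min ((2 ^ w - 1) ^ s) (2 ^ (s * w) - (2 ^ w - 1) ^ s) / 2 ^ (m + s * w)
    \<le> Pr clean (\<lambda>z. P (fst z) \<noteq> snd z)"
proof -
  let ?q = "(2 ^ w - 1) ^ s :: real" and ?k = "2 ^ (s * w) :: real"
  let ?B = "\<lambda>A b. {x \<in> cube dim. A x \<and> gate x \<and> some_tribe x = b}"
  have nP: "irrelevant_to_tribes (\<lambda>x. \<not> P x)" using P unfolding irrelevant_to_tribes_def by blast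
  have w1: "real (2 ^ w - 1) = 2 ^ w - 1" by (simp add: of_nat_diff)
  have U0: "real (card {u \<in> cube (s * w). has_tribe w s u = False}) = ?q"
    using card_not_has_tribe[of s w] by (simp only: of_nat_power w1 eq_False)
  have "card (cube (s * w)) = card {u \<in> cube (s * w). has_tribe w s u = True} +
      card {u \<in> cube (s * w). has_tribe w s u = False}"
    using card_split[of "cube (s * w)" "has_tribe w s"] by simp
  then have "real (card (cube (s * w))) = real (card {u \<in> cube (s * w). has_tribe w s u = True}) +
      real (card {u \<in> cube (s * w). has_tribe w s u = False})"
    by (simp only: of_nat_add)
  then have U1: "real (card {u \<in> cube (s * w). has_tribe w s u = True}) = ?k - ?q"
    unfolding U0 by (simp add: card_cube)
  have "card (cube r) = tails P + tails (\<lambda>x. \<not> P x)"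
    unfolding tails_def by (rule card_split) simp
  then have t: "real (tails P) + real (tails (\<lambda>x. \<not> P x)) = 2 ^ r"
    by (simp add: card_cube flip: of_nat_add)
  have "min ?q (?k - ?q) * 2 ^ r = min ?q (?k - ?q) * real (tails P) + min ?q (?k - ?q) * real (tails (\<lambda>x. \<not> P x))"
    by (simp only: t[symmetric] distrib_left)
  also have "\<dots> \<le> ?q * real (tails P) + (?k - ?q) * real (tails (\<lambda>x. \<not> P x))"
    by (intro add_mono mult_right_mono) auto
  also have "\<dots> = real (card (?B P False)) + real (card (?B (\<lambda>x. \<not> P x) True))"
    unfolding card_gate[OF P] card_gate[OF nP] of_nat_mult U0 U1 by simp
  also have "\<dots> = real (card (?B P False \<union> ?B (\<lambda>x. \<not> P x) True))"
    by (subst card_Un_disjoint) auto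
  also have "\<dots> \<le> real (card {x \<in> cube dim. P x \<noteq> target x})"
    unfolding of_nat_le_iff by (intro card_mono) (auto simp: target_def)
  finally have "min ?q (?k - ?q) * 2 ^ r / 2 ^ dim \<le> real (card {x \<in> cube dim. P x \<noteq> target x}) / 2 ^ dim"
    by (intro divide_right_mono) auto
  then show ?thesis by (simp add: Pr_clean dim_def power_add)
qed

lemma bad_output:
  assumes a: "balancing a" and G: "impurity G"
  shows "\<exists>T. td_output (proj_class dim) G (noisy a) t T \<and>
    min ((2 ^ w - 1) ^ s) (2 ^ (s * w) - (2 ^ w - 1) ^ s) / 2 ^ (m + s * w)
      \<le> Pr clean (\<lambda>z. dt_predict (noisy a) T (fst z) \<noteq> snd z)"
proof -
  define H' :: "(bool list \<Rightarrow> bool) set" where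
    "H' = (\<lambda>i x. x ! i) ` {i. i < dim \<and> (i < m \<or> m + s * w \<le> i)}"
  have irr: "irrelevant_to_tribes (leaf_of T)" if "set_dtree T \<subseteq> H'" for T
    unfolding irrelevant_to_tribes_def
  proof (intro ballI impI leaf_of_cong)
    fix x y :: "bool list" and h assume "\<forall>i<dim. i < m \<or> m + s * w \<le> i \<longrightarrow> x ! i = y ! i" "h \<in> set_dtree T"
    then show "h x = h y" using that by (auto simp: H'_def)
  qed
  have "m + s * w \<in> {i. i < dim \<and> (i < m \<or> m + s * w \<le> i)}" using r_pos by (simp add: dim_def)
  then have "H' \<noteq> {}" by (auto simp: H'_def)
  moreover have "finite H'" "H' \<subseteq> proj_class dim" by (auto simp: H'_def proj_class_def)
  moreover have "split_score G (noisy a) T l h = 0"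
    if T: "set_dtree T \<subseteq> H'" and h: "h \<in> proj_class dim - H'" for T l h
  proof -
    obtain i where i: "h = (\<lambda>x. x ! i)" "i < dim" using h by (auto simp: proj_class_def)
    have "\<not> (i < m \<or> m + s * w \<le> i)"
    proof
      assume "i < m \<or> m + s * w \<le> i"
      then have "h \<in> H'" unfolding H'_def i(1) by (intro imageI) (use i(2) in auto)
      then show False using h by simp
    qed
    then have "m \<le> i" "i < m + s * w" by auto
    then show ?thesis using split_score_tribe_var[OF a _ _ irr[OF T]] i(1) by simp
  qed
  ultimately obtain T where T: "td_output (proj_class dim) G (noisy a) t T" "set_dtree T \<subseteq> H'"
    using td_output_avoiding[OF G, of H' "proj_class dim" "noisy a" t] by blast
  \<comment> \<open>A prediction depends on the input only through the leaf reached.\<close>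
  have "irrelevant_to_tribes (dt_predict (noisy a) T)"
    using irr[OF T(2)] unfolding irrelevant_to_tribes_def dt_predict_def by metis
  from Pr_error[OF this] T(1) show ?thesis by blast
qed

lemma map_fst_clean: "map_pmf fst clean = pmf_of_set (cube dim)"
  by (simp add: clean_def pmf.map_comp comp_def)

lemma clean_deterministic: "z \<in> set_pmf clean \<Longrightarrow> snd z = target (fst z)"
  by (auto simp: clean_def)

lemma set_noisy: "set_pmf (noisy a) \<subseteq> cube dim \<times> UNIV"
proof -
  have "set_pmf clean \<subseteq> cube dim \<times> UNIV" "set_pmf corruption \<subseteq> cube dim \<times> UNIV"
    unfolding clean_def corruption_def
    by (auto simp: set_pmf_of_set) (auto simp: cube_def dim_def)
  then show ?thesis unfolding noisy_def mix_def by (auto split: if_splits)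
qed

lemma dTV_noisy: "balancing a \<Longrightarrow> dTV clean (noisy a) \<le> a"
  unfolding noisy_def balancing_def by (intro dTV_mix_le) auto

text \<open>Writing \<open>k\<close> for the fraction in \<open>balancing\<close>, the equation
  \<open>(1 - a) * k = a / 2\<close> has the solution
  \<open>a = 2 * k / (1 + 2 * k)\<close>.\<close>

lemma balancing_exists:
  obtains a where "balancing a" "a \<le> 2 * ((2 ^ w - 1) ^ s / ((2 ^ w - 1) * 2 ^ (m + s * w)))"
proof
  define k :: real where "k = (2 ^ w - 1) ^ s / ((2 ^ w - 1) * 2 ^ (m + s * w))"
  have k: "0 \<le> k" by (simp add: k_def)
  then show "balancing (2 * k / (1 + 2 * k))"
    unfolding balancing_def k_def[symmetric] by (simp add: divide_simps)
  have "2 * k / (1 + 2 * k) \<le> 2 * k / 1" using k by (intro divide_left_mono) auto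
  then show "2 * k / (1 + 2 * k) \<le> 2 * ((2 ^ w - 1) ^ s / ((2 ^ w - 1) * 2 ^ (m + s * w)))"
    by (simp add: k_def)
qed

end

section \<open>Assembly of the two distributions\<close>

theorem theorem4p1:
  "\<exists>c C :: real. c > 0 \<and> C > 0 \<and>
    (\<forall>(\<epsilon>::real) (\<gamma>::real) (d::nat) (\<eta>::real).
       0 < \<epsilon> \<and> \<epsilon> \<le> 1/6 \<and> 0 < \<gamma> \<and> \<gamma> < 1 \<and> \<gamma> powr (1/\<gamma>) \<le> \<epsilon> \<and>
       real d \<ge> C * ln (1/\<gamma>) / \<gamma> \<and> \<eta> \<ge> c * \<gamma> * \<epsilon> * ln (1/\<epsilon>) \<longrightarrow>
       (\<exists>(D :: (bool list \<times> bool) pmf) (Dh :: (bool list \<times> bool) pmf).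
          map_pmf fst D = pmf_of_set (cube d) \<and>
          (\<exists>f. \<forall>z\<in>set_pmf D. snd z = f (fst z)) \<and>
          set_pmf Dh \<subseteq> cube d \<times> UNIV \<and>
          dTV D Dh \<le> \<eta> \<and>
          weak_learning \<gamma> (proj_class d) D \<and>
          (\<forall>G. impurity G \<longrightarrow>
             (\<forall>t::nat. real t < 2 powr (real d - C * ln (1/\<gamma>) / \<gamma>) \<longrightarrow>
                (\<exists>T. td_output (proj_class d) G Dh t T \<and>
                     Pr D (\<lambda>z. dt_predict Dh T (fst z) \<noteq> snd z) > \<epsilon>)))))"
\<comment> \<open>Both constants come from \<open>tribes_parameters\<close>: 64 from the corruption
  weight, 4 from the dimension budget.\<close>
proof (rule exI[of _ 64], rule exI[of _ 4], intro conjI allI impI, simp_all only: zero_less_numeral, elim conjE)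
  fix \<epsilon> \<gamma> \<eta> :: real and d :: nat
  assume \<epsilon>: "0 < \<epsilon>" "\<epsilon> \<le> 1/6" and \<gamma>: "0 < \<gamma>" "\<gamma> < 1" "\<gamma> powr (1/\<gamma>) \<le> \<epsilon>"
    and d: "4 * ln (1/\<gamma>) / \<gamma> \<le> real d" and \<eta>: "64 * \<gamma> * \<epsilon> * ln (1/\<epsilon>) \<le> \<eta>"
  obtain m w s :: nat where w: "0 < w" "2 * \<gamma> * (2 ^ w - 1) \<le> 1"
    and dim: "real (m + s * w) + 1 \<le> 4 * ln (1 / \<gamma>) / \<gamma>"
    and wt: "2 * ((2 ^ w - 1) ^ s / ((2 ^ w - 1) * 2 ^ (m + s * w))) \<le> 64 * \<gamma> * \<epsilon>"
    and err: "\<epsilon> < min ((2 ^ w - 1) ^ s) (2 ^ (s * w) - (2 ^ w - 1) ^ s) / 2 ^ (m + s * w)"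
    using tribes_parameters[OF \<epsilon> \<gamma>(1,3)] by blast
  define r where "r = d - (m + s * w)"
  have "real (m + s * w + 1) \<le> real d" using dim d by simp
  then have r: "0 < r" "m + s * w + r = d" unfolding r_def of_nat_le_iff by linarith+
  interpret tribes m w s r by unfold_locales (use w r in auto)
  have dd: "dim = d" using r by (simp add: dim_def)
  obtain a where a: "balancing a" "a \<le> 2 * ((2 ^ w - 1) ^ s / ((2 ^ w - 1) * 2 ^ (m + s * w)))"
    using balancing_exists by blast
  \<comment> \<open>Shows \<open>ln (1 / \<epsilon>) \<ge> 1\<close>, so that the weight bound
    \<open>64 * \<gamma> * \<epsilon>\<close> is at most \<open>\<eta>\<close>.\<close>
  have "3 \<le> 1 / \<epsilon>" using \<epsilon> by (simp add: field_simps)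
  then have "ln (exp 1) \<le> ln (1 / \<epsilon>)" using exp_le \<epsilon> by (subst ln_le_cancel_iff) auto
  then have "64 * \<gamma> * \<epsilon> * 1 \<le> 64 * \<gamma> * \<epsilon> * ln (1 / \<epsilon>)" using \<epsilon> \<gamma> by (intro mult_left_mono) auto
  then have "dTV clean (noisy a) \<le> \<eta>" using dTV_noisy[OF a(1)] a(2) wt \<eta> by linarith
  moreover have "\<exists>T. td_output (proj_class d) G (noisy a) t T \<and>
      Pr clean (\<lambda>z. dt_predict (noisy a) T (fst z) \<noteq> snd z) > \<epsilon>" if G: "impurity G" for G t
  proof -
    obtain T where "td_output (proj_class d) G (noisy a) t T"
      "min ((2 ^ w - 1) ^ s) (2 ^ (s * w) - (2 ^ w - 1) ^ s) / 2 ^ (m + s * w)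
        \<le> Pr clean (\<lambda>z. dt_predict (noisy a) T (fst z) \<noteq> snd z)"
      using bad_output[OF a(1) G, of t] unfolding dd by blast
    then show ?thesis using less_le_trans[OF err] by blast
  qed
  moreover have "map_pmf fst clean = pmf_of_set (cube d)" "set_pmf (noisy a) \<subseteq> cube d \<times> UNIV"
    "weak_learning \<gamma> (proj_class d) clean"
    using map_fst_clean set_noisy[of a] weak_learning_clean[OF \<gamma>(1) w(2)] unfolding dd .
  moreover have "\<exists>f. \<forall>z\<in>set_pmf clean. snd z = f (fst z)" using clean_deterministic by blast
  ultimately show "\<exists>D Dh. map_pmf fst D = pmf_of_set (cube d) \<and>
      (\<exists>f. \<forall>z\<in>set_pmf D. snd z = f (fst z)) \<and> set_pmf Dh \<subseteq> cube d \<times> UNIV \<and> dTV D Dh \<le> \<eta> \<and>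
      weak_learning \<gamma> (proj_class d) D \<and>
      (\<forall>G. impurity G \<longrightarrow> (\<forall>t::nat. real t < 2 powr (real d - 4 * ln (1/\<gamma>) / \<gamma>) \<longrightarrow>
         (\<exists>T. td_output (proj_class d) G Dh t T \<and>
              Pr D (\<lambda>z. dt_predict Dh T (fst z) \<noteq> snd z) > \<epsilon>)))"
    by (intro exI[of _ clean] exI[of _ "noisy a"]) simp
qed

end
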